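(* Let $X$ be a space with a multiplicative lattice of open maps. Then every space co-absolute with $X$ has a multiplicative lattice of semi-open maps.
   Context: All spaces are Tychonoff and all single-valued maps are continuous; $w(X)$ denotes the weight of $X$. A map $f\colon X\to Y$ is semi-open if $\operatorname{Int}_Y f(U)\neq\varnothing$ for every nonempty open $U\subset X$. For maps $\phi,f$ with common domain $X$, $\phi\prec f$ means that there is a continuous map $g\colon \phi(X)\to f(X)$ with $f=g\circ\phi$. A multiplicative lattice on $X$ is a family $\Psi$ of maps with domain $X$ (each $\phi\in\Psi$ regarded as a map onto $\phi(X)$; maps differing by a homeomorphism of their ranges are identified) such that: (L1) for any map $f\colon X\to f(X)$ there is $\phi\in\Psi$ with $\phi\prec f$ and $w(\phi(X))\le w(f(X))$; (L2) if $\{\phi_\alpha:\alpha\in A\}\subset\Psi$, then the diagonal product $\triangle\{\phi_\alpha:\alpha\in A\}$ belongs to $\Psi$. It is a multiplicative lattice of open (resp. semi-open) maps if every $\phi\in\Psi$ is open (resp. semi-open) as a map onto $\phi(X)$. The absolute of a space $X$ is the (unique up to homeomorphism) extremally disconnected space admitting a perfect irreducible map onto $X$. Two spaces are co-absolute if their absolutes are homeomorphic. *)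

theory Defs
  imports "HOL-Analysis.Analysis"
begin

unbundle cardinal_syntax

definition tychonoff_space :: "'a topology \<Rightarrow> bool" where
  "tychonoff_space X \<longleftrightarrow> completely_regular_space X \<and> Hausdorff_space X"


subsection \<open>Weight\<close>

definition base_of :: "'a topology \<Rightarrow> 'a set set \<Rightarrow> bool" where
  "base_of X \<B> \<longleftrightarrow> openin X = arbitrary union_of (\<lambda>U. U \<in> \<B>)"

text \<open>
  Cardinal functions take infinite values only: the weight is the least cardinality of a base or
  \<open>\<aleph>\<^sub>0\<close>, whichever is larger (a sum with an infinite summand is the maximum). Without this
  convention condition (L1) below would force every map onto a finite discrete space to be a member
  of every multiplicative lattice. The choice below is well-defined and minimal by
  \<open>weight_minimal\<close>.
\<close>

definition weight :: "'a topology \<Rightarrow> (nat + 'a set) rel" where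
  "weight X = natLeq +c |SOME \<B>. base_of X \<B> \<and> (\<forall>\<B>'. base_of X \<B>' \<longrightarrow> |\<B>| \<le>o |\<B>'| )|"

lemma minimal_base_exists:
  "\<exists>\<B>. base_of X \<B> \<and> (\<forall>\<B>'. base_of X \<B>' \<longrightarrow> |\<B>| \<le>o |\<B>'| )"
proof -
  let ?R = "card_of ` Collect (base_of X)"
  have "base_of X (Collect (openin X))"
    by (auto simp: base_of_def openin_topology_base_unique)
  then have "?R \<noteq> {}" by auto
  moreover have "\<forall>r\<in>?R. Card_order r" by (simp add: card_of_Card_order)
  ultimately have "\<exists>r\<in>?R. \<forall>r'\<in>?R. r \<le>o r'"
    by (rule exists_minim_Card_order)
  then show ?thesis by simp
qed

lemma weight_minimal:
  shows "\<exists>\<B>. base_of X \<B> \<and> weight X = natLeq +c |\<B>|"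
    and "base_of X \<B> \<Longrightarrow> weight X \<le>o natLeq +c |\<B>|"
proof -
  define \<B>0 where "\<B>0 = (SOME \<B>. base_of X \<B> \<and> (\<forall>\<B>'. base_of X \<B>' \<longrightarrow> |\<B>| \<le>o |\<B>'| ))"
  have *: "base_of X \<B>0 \<and> (\<forall>\<B>'. base_of X \<B>' \<longrightarrow> |\<B>0| \<le>o |\<B>'| )"
    unfolding \<B>0_def by (rule someI_ex[OF minimal_base_exists])
  have w: "weight X = natLeq +c |\<B>0|"
    by (simp only: weight_def \<B>0_def)
  show "\<exists>\<B>. base_of X \<B> \<and> weight X = natLeq +c |\<B>|"
    using * w by (intro exI[of _ \<B>0]) simp
  show "weight X \<le>o natLeq +c |\<B>|" if "base_of X \<B>"
    unfolding w by (rule csum_mono2) (use * that in simp)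
qed


subsection \<open>Maps with a given domain\<close>

text \<open>
  A map with domain \<open>X\<close> is a function together with the topology of its range. Ranges are taken up
  to homeomorphism and never have more points than \<open>X\<close>, so (for \<open>X :: 'a topology\<close>) ranges living
  on the type \<open>'a\<close> represent all maps with domain \<open>X\<close>; see \<open>onto_map_representable\<close>.
\<close>

type_synonym ('a, 'b) top_map = "('a \<Rightarrow> 'b) \<times> 'b topology"

definition onto_map :: "'a topology \<Rightarrow> ('a, 'b) top_map \<Rightarrow> bool" where
  "onto_map X \<phi> \<longleftrightarrow> tychonoff_space (snd \<phi>) \<and> continuous_map X (snd \<phi>) (fst \<phi>)
     \<and> fst \<phi> ` topspace X = topspace (snd \<phi>)"

definition same_map :: "'a topology \<Rightarrow> ('a, 'b) top_map \<Rightarrow> ('a, 'c) top_map \<Rightarrow> bool" where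
  "same_map X \<phi> \<psi> \<longleftrightarrow>
     (\<exists>h. homeomorphic_map (snd \<phi>) (snd \<psi>) h \<and> (\<forall>x\<in>topspace X. fst \<psi> x = h (fst \<phi> x)))"

definition map_prec :: "'a topology \<Rightarrow> ('a, 'b) top_map \<Rightarrow> ('a, 'c) top_map \<Rightarrow> bool" where
  "map_prec X \<phi> f \<longleftrightarrow>
     (\<exists>g. continuous_map (snd \<phi>) (snd f) g \<and> (\<forall>x\<in>topspace X. fst f x = g (fst \<phi> x)))"

text \<open>The diagonal product of a set of maps, as a map onto its image in the product of the ranges.\<close>

definition diagonal_map ::
    "'a topology \<Rightarrow> ('a, 'b) top_map set \<Rightarrow> ('a, ('a, 'b) top_map \<Rightarrow> 'b) top_map" where
  "diagonal_map X F =
     (let \<Delta> = (\<lambda>x. \<lambda>\<phi>\<in>F. fst \<phi> x)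
      in (\<Delta>, subtopology (product_topology snd F) (\<Delta> ` topspace X)))"

definition semi_open_map :: "'a topology \<Rightarrow> 'b topology \<Rightarrow> ('a \<Rightarrow> 'b) \<Rightarrow> bool" where
  "semi_open_map X Y f \<longleftrightarrow>
     (\<forall>U. openin X U \<and> U \<noteq> {} \<longrightarrow> Y interior_of (f ` U) \<noteq> {})"

lemma onto_map_representable:
  fixes X :: "'a topology" and f :: "('a, 'b) top_map"
  assumes "onto_map X f"
  shows "\<exists>g :: ('a, 'a) top_map. onto_map X g \<and> same_map X f g"
proof -
  obtain u Z where f: "f = (u, Z)" by fastforce
  have cu: "continuous_map X Z u" and im: "u ` topspace X = topspace Z" and tZ: "tychonoff_space Z"
    using assms by (auto simp: onto_map_def f)
  define h where "h = inv_into (topspace X) u"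
  define S where "S = h ` topspace Z"
  define Y where "Y = pullback_topology S u Z"
  have uh: "u (h z) = z" if "z \<in> topspace Z" for z
    using that im by (metis f_inv_into_f h_def)
  have tY: "topspace Y = S"
    using uh by (auto simp: Y_def topspace_pullback_topology S_def)
  have hu: "h (u y) = y" if "y \<in> S" for y
    using that uh by (auto simp: S_def)
  have "continuous_map Y Z u"
    using continuous_map_pullback[of Z Z id S u] by (simp add: Y_def)
  moreover have "continuous_map Z Y h"
    unfolding Y_def
  proof (rule continuous_map_pullback')
    show "continuous_map Z Z (u \<circ> h)"
      by (rule continuous_map_eq[OF continuous_map_id]) (simp add: uh)
    show "topspace Z \<subseteq> h -` S" by (auto simp: S_def)
  qed
  ultimately have "homeomorphic_maps Z Y h u"
    using uh hu tY by (auto simp: homeomorphic_maps_def)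
  then have hom: "homeomorphic_map Z Y h"
    by (rule homeomorphic_maps_imp_map)
  then have "Z homeomorphic_space Y"
    by (rule homeomorphic_map_imp_homeomorphic_space)
  then have "tychonoff_space Y"
    using tZ homeomorphic_completely_regular_space homeomorphic_Hausdorff_space
    by (metis tychonoff_space_def)
  moreover have "continuous_map X Y (h \<circ> u)"
    using cu hom continuous_map_compose homeomorphic_imp_continuous_map by blast
  moreover have "(h \<circ> u) ` topspace X = topspace Y"
    by (metis image_comp im tY S_def)
  ultimately have "onto_map X (h \<circ> u, Y)"
    by (simp add: onto_map_def)
  moreover have "same_map X f (h \<circ> u, Y)"
    using hom by (auto simp: same_map_def f)
  ultimately show ?thesis by blast
qed


subsection \<open>Multiplicative lattices\<close>

text \<open>
  \<open>\<Psi>\<close> contains representatives of the members of the family, so membership of the diagonal product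
  is membership up to a homeomorphism of ranges. Repeating a factor changes a diagonal product only
  by such a homeomorphism, so subsets \<open>F \<subseteq> \<Psi>\<close> account for all indexed subfamilies.
\<close>

definition multiplicative_lattice :: "'a topology \<Rightarrow> ('a, 'a) top_map set \<Rightarrow> bool" where
  "multiplicative_lattice X \<Psi> \<longleftrightarrow>
     (\<forall>\<phi>\<in>\<Psi>. onto_map X \<phi>) \<and>
     (\<forall>f :: ('a, 'a) top_map. onto_map X f \<longrightarrow>
        (\<exists>\<phi>\<in>\<Psi>. map_prec X \<phi> f \<and> weight (snd \<phi>) \<le>o weight (snd f))) \<and>
     (\<forall>F\<subseteq>\<Psi>. \<exists>\<psi>\<in>\<Psi>. same_map X \<psi> (diagonal_map X F))"

definition multiplicative_lattice_of_open_maps ::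
    "'a topology \<Rightarrow> ('a, 'a) top_map set \<Rightarrow> bool" where
  "multiplicative_lattice_of_open_maps X \<Psi> \<longleftrightarrow>
     multiplicative_lattice X \<Psi> \<and> (\<forall>\<phi>\<in>\<Psi>. open_map X (snd \<phi>) (fst \<phi>))"

definition multiplicative_lattice_of_semi_open_maps ::
    "'a topology \<Rightarrow> ('a, 'a) top_map set \<Rightarrow> bool" where
  "multiplicative_lattice_of_semi_open_maps X \<Psi> \<longleftrightarrow>
     multiplicative_lattice X \<Psi> \<and> (\<forall>\<phi>\<in>\<Psi>. semi_open_map X (snd \<phi>) (fst \<phi>))"


subsection \<open>Absolutes\<close>

definition extremally_disconnected_space :: "'a topology \<Rightarrow> bool" where
  "extremally_disconnected_space X \<longleftrightarrow> (\<forall>U. openin X U \<longrightarrow> openin X (X closure_of U))"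

definition irreducible_map :: "'a topology \<Rightarrow> 'b topology \<Rightarrow> ('a \<Rightarrow> 'b) \<Rightarrow> bool" where
  "irreducible_map X Y f \<longleftrightarrow> f ` topspace X = topspace Y \<and>
     (\<forall>C. closedin X C \<and> C \<noteq> topspace X \<longrightarrow> f ` C \<noteq> topspace Y)"

definition is_absolute :: "'e topology \<Rightarrow> 'a topology \<Rightarrow> bool" where
  "is_absolute E X \<longleftrightarrow> tychonoff_space E \<and> extremally_disconnected_space E
     \<and> (\<exists>p. perfect_map E X p \<and> irreducible_map E X p)"

end

theory Submission
  imports Defs "HOL-Library.Countable_Set_Type"
begin

text \<open>
  A map with domain \<open>X\<close> and Tychonoff range is determined, up to a homeomorphism of the range,
  by the topology that it induces on the points of \<open>X\<close>: a completely regular topology coarser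
  than that of \<open>X\<close>. Under this dictionary \<open>\<phi> \<prec> f\<close> is inclusion of topologies, the diagonal
  product is the join, and \<open>\<phi>\<close> is open if and only if the saturation of every open set is open
  in the induced topology. A multiplicative lattice becomes a family of coarser topologies that
  is closed under joins and cofinal with control of weight. All constructions below take place
  among such topologies; the dictionary is applied at the end.

  Let \<open>p : E \<rightarrow> X\<close> and \<open>q : E \<rightarrow> Y\<close> be perfect irreducible maps from a common absolute. An open
  \<open>V \<subseteq> Y\<close> is moved to \<open>to_X V = {x. p\<inverse>(x) \<subseteq> q\<inverse>(V)}\<close>, which is open, is nonempty if \<open>V\<close> is, and
  respects finite intersections exactly and unions up to closure; \<open>to_Y\<close> goes the other way.
  Call a coarser topology \<open>\<sigma>\<close> on \<open>Y\<close> linked to a member \<open>\<tau>\<close> of the lattice of \<open>X\<close> if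

    \<^item> the closure of \<open>to_X V\<close> is \<open>\<tau>\<close>-saturated for each \<open>\<sigma>\<close>-open \<open>V\<close>
      (\<open>closures_saturated\<close>), and
    \<^item> the \<open>\<sigma>\<close>-open subsets of \<open>to_Y B\<close> are dense in it for each \<open>\<tau>\<close>-open \<open>B\<close>
      (\<open>densely_approximated\<close>).

  The topologies on \<open>Y\<close> that are linked to some \<open>\<tau>\<close> form the required lattice.

  Linked topologies are semi-open. By the first condition and compactness of the fibres of \<open>p\<close>,
  the compact set \<open>q(p\<inverse>(x))\<close> depends, up to \<open>\<sigma>\<close>-indistinguishability, only on the \<open>\<tau>\<close>-class of
  \<open>x\<close> (\<open>indist_fibres\<close>). For a nonempty open \<open>U \<subseteq> Y\<close> let \<open>B\<close> be the \<open>\<tau>\<close>-saturation of \<open>to_X U\<close>,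
  which is \<open>\<tau>\<close>-open. By the second condition some nonempty \<open>\<sigma>\<close>-open \<open>W\<close> lies in \<open>to_Y B\<close>, and
  every point of \<open>W\<close> is indistinguishable from a point of \<open>U\<close> (\<open>semi_open_coarsening\<close>). Arguing
  with points of the fibres, instead of closures of images, is what makes this valid for
  noncompact spaces.

  Both conditions pass to joins: each says that all open sets belong to a class that is closed
  under finite intersections and unions, so that a subbase decides. It remains to find, for any
  given \<open>\<rho>\<close> on \<open>Y\<close>, a finer linked topology of no larger weight. One alternates two steps
  countably often and takes joins: for given \<open>\<sigma>\<close> find \<open>\<tau>\<close> with the first property, for given \<open>\<tau>\<close>
  find \<open>\<sigma>\<close> with the second one, without raising the weight. Each step treats one member of a
  base at a time and needs, for a single open set, a topology of countable weight. This is where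
  the chain condition enters: a space with a lattice of open maps satisfies it
  (\<open>open_lattice_imp_ccc\<close>), it passes from \<open>X\<close> to \<open>Y\<close> (\<open>ccc_transfer\<close>), and it lets every open
  set be approximated from inside by a dense union of countably many cozero sets.
\<close>

section \<open>Weight of pullback topologies\<close>

lemma base_of_iff:
  "base_of X \<B> \<longleftrightarrow> (\<forall>V\<in>\<B>. openin X V) \<and>
     (\<forall>U x. openin X U \<and> x \<in> U \<longrightarrow> (\<exists>V\<in>\<B>. x \<in> V \<and> V \<subseteq> U))"
  unfolding base_of_def openin_topology_base_unique by blast

lemma Cinfinite_weight: "Cinfinite (weight X)"
  unfolding weight_def by (intro Cinfinite_csum1 natLeq_Cinfinite)

lemma natLeq_le_weight: "natLeq \<le>o weight X"
  unfolding weight_def by (rule ordLeq_csum1) (rule natLeq_Card_order)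

lemma obtain_weight_base:
  obtains \<B> where "base_of X \<B>" "|\<B>| \<le>o weight X"
proof -
  obtain \<B> where B: "base_of X \<B>" "weight X = natLeq +c |\<B>|"
    using weight_minimal(1) by blast
  have "|\<B>| \<le>o natLeq +c |\<B>|"
    by (rule ordLeq_csum2) (rule card_of_Card_order)
  with B(1) that show ?thesis unfolding B(2) by blast
qed

lemma weight_le_if_base:
  assumes "base_of X \<B>" "|\<B>| \<le>o \<kappa>" "Cinfinite \<kappa>" "natLeq \<le>o \<kappa>"
  shows "weight X \<le>o \<kappa>"
proof -
  have "natLeq +c |\<B>| \<le>o \<kappa>"
    by (rule csum_cinfinite_bound)
      (use assms natLeq_Card_order card_of_Card_order in auto)
  with weight_minimal(2)[OF assms(1)] show ?thesis
    by (rule ordLeq_transitive)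
qed

text \<open>
  The preimages of a base form a base of the pullback.
\<close>

lemma weight_pullback_le:
  "weight (pullback_topology S h Z) \<le>o weight Z"
proof -
  obtain \<B> where B: "base_of Z \<B>" "|\<B>| \<le>o weight Z" by (rule obtain_weight_base)
  let ?C = "(\<lambda>V. h -` V \<inter> S) ` \<B>"
  have "base_of (pullback_topology S h Z) ?C"
    unfolding base_of_iff
  proof (intro conjI ballI allI impI)
    fix V assume "V \<in> ?C"
    then show "openin (pullback_topology S h Z) V"
      using B(1) by (auto simp: base_of_iff openin_pullback_topology)
  next
    fix U x assume "openin (pullback_topology S h Z) U \<and> x \<in> U"
    then obtain W where W: "openin Z W" "U = h -` W \<inter> S" "h x \<in> W" "x \<in> S"
      by (auto simp: openin_pullback_topology)
    then obtain V where "V \<in> \<B>" "h x \<in> V" "V \<subseteq> W"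
      using B(1) unfolding base_of_iff by meson
    then show "\<exists>V\<in>?C. x \<in> V \<and> V \<subseteq> U"
      using W by (intro bexI[of _ "h -` V \<inter> S"]) auto
  qed
  moreover have "|?C| \<le>o weight Z"
    using card_of_image B(2) by (rule ordLeq_transitive)
  ultimately show ?thesis
    using Cinfinite_weight natLeq_le_weight by (rule weight_le_if_base)
qed

text \<open>
  For a surjection the open sets of \<open>Z\<close> are recovered as images of their own preimages, so a
  base can be pushed forward as well.
\<close>

lemma weight_le_pullback:
  assumes onto: "h ` S = topspace Z"
  shows "weight Z \<le>o weight (pullback_topology S h Z)"
proof -
  let ?P = "pullback_topology S h Z"
  obtain \<B> where B: "base_of ?P \<B>" "|\<B>| \<le>o weight ?P" by (rule obtain_weight_base)
  have img: "h ` (h -` V \<inter> S) = V" if "openin Z V" for V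
    using onto openin_subset[OF that] by force
  have "base_of Z (image h ` \<B>)"
    unfolding base_of_iff
  proof (intro conjI ballI allI impI)
    fix V assume "V \<in> image h ` \<B>"
    then obtain C where C: "C \<in> \<B>" "V = h ` C" by blast
    have "openin ?P C" using B(1) C(1) by (simp add: base_of_iff)
    then obtain W where W: "openin Z W" "C = h -` W \<inter> S"
      by (auto simp: openin_pullback_topology)
    then have "V = W" unfolding C(2) W(2) using img by blast
    then show "openin Z V" using W(1) by simp
  next
    fix U y assume U: "openin Z U \<and> y \<in> U"
    then have "y \<in> topspace Z" using openin_subset[of Z U] by auto
    then obtain x where x: "x \<in> S" "h x = y" unfolding onto[symmetric] by auto
    have "openin ?P (h -` U \<inter> S)" using U by (auto simp: openin_pullback_topology)
    moreover have "x \<in> h -` U \<inter> S" using U x by auto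
    ultimately obtain C where C: "C \<in> \<B>" "x \<in> C" "C \<subseteq> h -` U \<inter> S"
      using B(1) unfolding base_of_iff by blast
    then show "\<exists>V\<in>image h ` \<B>. y \<in> V \<and> V \<subseteq> U" using x by blast
  qed
  moreover have "|image h ` \<B>| \<le>o weight ?P"
    using card_of_image B(2) by (rule ordLeq_transitive)
  ultimately show ?thesis
    using Cinfinite_weight natLeq_le_weight by (rule weight_le_if_base)
qed

section \<open>Joins of topologies\<close>

text \<open>
  The carrier \<open>S\<close> is an explicit generator, so that the join of the empty family is the
  indiscrete topology on \<open>S\<close>.
\<close>

definition join :: "'a set \<Rightarrow> 'a topology set \<Rightarrow> 'a topology" where
  "join S \<T> = topology_generated_by (insert S (\<Union>\<tau>\<in>\<T>. Collect (openin \<tau>)))"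

lemma openin_join_member: "\<tau> \<in> \<T> \<Longrightarrow> openin \<tau> U \<Longrightarrow> openin (join S \<T>) U"
  unfolding join_def by (rule topology_generated_by_Basis) auto

lemma openin_join_carrier: "openin (join S \<T>) S"
  unfolding join_def by (rule topology_generated_by_Basis) auto

text \<open>
  Most closure properties of joins are shown by this rule: a property of open sets that survives
  finite intersections and unions only needs to be checked on the given topologies.
\<close>

lemma join_induct [consumes 1, case_names carrier member Int Union]:
  assumes "openin (join S \<T>) U"
    and "P S"
    and "\<And>\<tau> U. \<tau> \<in> \<T> \<Longrightarrow> openin \<tau> U \<Longrightarrow> P U"
    and "\<And>U V. openin (join S \<T>) U \<Longrightarrow> openin (join S \<T>) V \<Longrightarrow> P U \<Longrightarrow> P V \<Longrightarrow> P (U \<inter> V)"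
    and "\<And>\<K>. (\<And>U. U \<in> \<K> \<Longrightarrow> openin (join S \<T>) U) \<Longrightarrow> (\<And>U. U \<in> \<K> \<Longrightarrow> P U) \<Longrightarrow> P (\<Union>\<K>)"
  shows "P U"
proof -
  let ?G = "insert S (\<Union>\<tau>\<in>\<T>. Collect (openin \<tau>))"
  have "generate_topology_on ?G U"
    using assms(1) by (simp add: join_def openin_topology_generated_by_iff)
  then have "openin (join S \<T>) U \<and> P U"
  proof induction
    case Empty
    then show ?case using assms(5)[of "{}"] by simp
  next
    case (Int a b)
    then show ?case using assms(4) by blast
  next
    case (UN K)
    then show ?case using assms(5)[of K] by blast
  next
    case (Basis s)
    then show ?case
      using assms(2,3) openin_join_carrier openin_join_member by fastforce
  qed
  then show ?thesis ..
qed

lemma topspace_join: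
  assumes "\<And>\<tau>. \<tau> \<in> \<T> \<Longrightarrow> topspace \<tau> = S"
  shows "topspace (join S \<T>) = S"
  using assms by (auto simp: join_def dest: openin_subset)

lemma join_least:
  assumes "openin (join S \<T>) U" "openin \<sigma> S"
    and "\<And>\<tau> U. \<tau> \<in> \<T> \<Longrightarrow> openin \<tau> U \<Longrightarrow> openin \<sigma> U"
  shows "openin \<sigma> U"
  using assms(1) by (induction rule: join_induct) (use assms(2,3) in auto)

text \<open>
  Both sides are the coarsest topology on \<open>S\<close> that makes all \<open>h i\<close> continuous. With identity
  maps this presents a join as a pullback of a product; with the members of a lattice it
  computes the topology of a diagonal product.
\<close>

lemma pullback_product_eq_join:
  assumes h: "\<And>i. i \<in> I \<Longrightarrow> h i ` S \<subseteq> topspace (T i)"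
  shows "pullback_topology S (\<lambda>x. \<lambda>i\<in>I. h i x) (product_topology T I)
       = join S ((\<lambda>i. pullback_topology S (h i) (T i)) ` I)" (is "?P = join S ?\<T>")
proof -
  let ?\<Delta> = "\<lambda>x. \<lambda>i\<in>I. h i x"
  have J: "topspace (join S ?\<T>) = S"
    by (rule topspace_join) (use h in \<open>fastforce simp: topspace_pullback_topology\<close>)
  have 1: "openin (join S ?\<T>) U" if P: "openin ?P U" for U
  proof -
    obtain V where V: "openin (product_topology T I) V" "U = ?\<Delta> -` V \<inter> S"
      using P by (auto simp: openin_pullback_topology)
    have "continuous_map (join S ?\<T>) (T i) (h i)" if i: "i \<in> I" for i
      unfolding continuous_map
    proof (intro conjI allI impI)
      show "h i ` topspace (join S ?\<T>) \<subseteq> topspace (T i)" using h i J by auto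
    next
      fix W assume "openin (T i) W"
      then have "openin (pullback_topology S (h i) (T i)) (h i -` W \<inter> S)"
        by (auto simp: openin_pullback_topology)
      then have "openin (join S ?\<T>) (h i -` W \<inter> S)"
        using i by (intro openin_join_member) auto
      moreover have "h i -` W \<inter> S = {x \<in> topspace (join S ?\<T>). h i x \<in> W}"
        using J by auto
      ultimately show "openin (join S ?\<T>) {x \<in> topspace (join S ?\<T>). h i x \<in> W}"
        by simp
    qed
    then have "continuous_map (join S ?\<T>) (product_topology T I) ?\<Delta>"
      by (auto simp: continuous_map_componentwise)
    then have "openin (join S ?\<T>) {x \<in> topspace (join S ?\<T>). ?\<Delta> x \<in> V}"
      using V(1) by (rule openin_continuous_map_preimage)
    moreover have "{x \<in> topspace (join S ?\<T>). ?\<Delta> x \<in> V} = U"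
      using V(2) J by auto
    ultimately show ?thesis by simp
  qed
  have 2: "openin ?P U" if "openin (join S ?\<T>) U" for U
    using that
  proof (rule join_least)
    have "S = ?\<Delta> -` topspace (product_topology T I) \<inter> S"
      using h by (auto simp: image_subset_iff)
    then show "openin ?P S"
      unfolding openin_pullback_topology by blast
  next
    fix \<tau> U assume "\<tau> \<in> ?\<T>" "openin \<tau> U"
    then obtain i W where i: "i \<in> I" "openin (T i) W" "U = h i -` W \<inter> S"
      by (auto simp: openin_pullback_topology)
    have "openin (product_topology T I) {f \<in> topspace (product_topology T I). f i \<in> W}"
      using continuous_map_product_projection[OF i(1)] i(2)
      by (rule openin_continuous_map_preimage)
    moreover have "U = ?\<Delta> -` {f \<in> topspace (product_topology T I). f i \<in> W} \<inter> S"
      using i h by (auto simp: image_subset_iff)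
    ultimately show "openin ?P U"
      unfolding openin_pullback_topology by blast
  qed
  from 1 2 show ?thesis by (auto simp: topology_eq)
qed

lemma completely_regular_space_pullback:
  assumes Z: "completely_regular_space Z" and h: "h ` S \<subseteq> topspace Z"
  shows "completely_regular_space (pullback_topology S h Z)"
  unfolding completely_regular_space_alt'
proof (intro allI impI)
  fix U x assume "openin (pullback_topology S h Z) U" and x: "x \<in> U"
  then obtain V where V: "openin Z V" "U = h -` V \<inter> S"
    by (auto simp: openin_pullback_topology)
  then obtain f where f: "continuous_map Z euclideanreal f" "f (h x) = 0"
      "f ` (topspace Z - V) \<subseteq> {1}"
    using Z x unfolding completely_regular_space_alt' by blast
  have "continuous_map (pullback_topology S h Z) euclideanreal (f \<circ> h)"
    using f(1) by (rule continuous_map_pullback)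
  moreover have "(f \<circ> h) ` (topspace (pullback_topology S h Z) - U) \<subseteq> {1}"
    using f(3) V(2) by (auto simp: topspace_pullback_topology)
  ultimately show "\<exists>f. continuous_map (pullback_topology S h Z) euclideanreal f \<and> f x = 0 \<and>
      f ` (topspace (pullback_topology S h Z) - U) \<subseteq> {1}"
    using f(2) by (intro exI[of _ "f \<circ> h"]) auto
qed

lemma pullback_topology_self:
  assumes "topspace \<tau> = S"
  shows "pullback_topology S (\<lambda>x. x) \<tau> = \<tau>"
  using assms openin_subset by (fastforce simp: topology_eq openin_pullback_topology)

lemma completely_regular_space_join:
  assumes "\<And>\<tau>. \<tau> \<in> \<T> \<Longrightarrow> topspace \<tau> = S" "\<And>\<tau>. \<tau> \<in> \<T> \<Longrightarrow> completely_regular_space \<tau>"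
  shows "completely_regular_space (join S \<T>)"
proof -
  have "join S \<T> = join S ((\<lambda>\<tau>. pullback_topology S (\<lambda>x. x) \<tau>) ` \<T>)"
    using assms(1) by (simp add: pullback_topology_self)
  also have "\<dots> = pullback_topology S (\<lambda>x. \<lambda>\<tau>\<in>\<T>. x) (product_topology (\<lambda>\<tau>. \<tau>) \<T>)"
    by (rule pullback_product_eq_join[symmetric]) (use assms in auto)
  also have "completely_regular_space \<dots>"
    by (rule completely_regular_space_pullback)
      (use assms in \<open>auto simp: completely_regular_space_product_topology\<close>)
  finally show ?thesis .
qed

text \<open>
  Grading finite intersections by their length makes the count an induction on unions of at most
  \<open>\<kappa>\<close> images.
\<close>

primrec finite_meets :: "'a set \<Rightarrow> 'a set set \<Rightarrow> nat \<Rightarrow> 'a set set" where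
  "finite_meets S \<G> 0 = {S}"
| "finite_meets S \<G> (Suc n) = (\<Union>A\<in>finite_meets S \<G> n. (\<inter>) A ` \<G>)"

lemma finite_meets_Int:
  assumes "\<And>G. G \<in> \<G> \<Longrightarrow> G \<subseteq> S" "A \<in> finite_meets S \<G> m" "B \<in> finite_meets S \<G> n"
  shows "A \<inter> B \<in> finite_meets S \<G> (m + n)"
  using assms(3)
proof (induction n arbitrary: B)
  case 0
  have "A \<subseteq> S"
    using assms(2) by (cases m) (use assms(1) in auto)
  then show ?case using 0 assms(2) by (simp add: Int_absorb2)
next
  case (Suc n)
  then obtain C G where "C \<in> finite_meets S \<G> n" "G \<in> \<G>" "B = C \<inter> G" by auto
  moreover from this have "A \<inter> C \<in> finite_meets S \<G> (m + n)" using Suc.IH by blast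
  ultimately show ?case by (auto simp: Int_assoc[symmetric])
qed

lemma card_finite_meets:
  assumes "|\<G>| \<le>o \<kappa>" "Cinfinite \<kappa>"
  shows "|\<Union>n. finite_meets S \<G> n| \<le>o \<kappa>"
proof (rule UNION_Cinfinite_bound)
  show nat: "|UNIV :: nat set| \<le>o \<kappa>"
    using card_of_nat natLeq_ordLeq_cinfinite[OF assms(2)] by (rule ordIso_ordLeq_trans)
  show "\<forall>n\<in>UNIV. |finite_meets S \<G> n| \<le>o \<kappa>"
  proof
    fix n show "|finite_meets S \<G> n| \<le>o \<kappa>"
    proof (induction n)
      case 0
      have "|{S}| \<le>o |UNIV :: nat set|" by (rule card_of_singl_ordLeq) auto
      then show ?case
        unfolding finite_meets.simps
        by (rule ordLeq_transitive) (rule nat)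
    next
      case (Suc n)
      show ?case
        unfolding finite_meets.simps
        by (rule UNION_Cinfinite_bound[OF Suc _ assms(2)])
          (intro ballI ordLeq_transitive[OF card_of_image assms(1)])
    qed
  qed
qed (rule assms(2))

text \<open>
  The finite intersections of members of given bases form a base of the join, and there are at
  most \<open>\<kappa>\<close> of them.
\<close>

lemma weight_join_le:
  assumes top: "\<And>\<tau>. \<tau> \<in> \<T> \<Longrightarrow> topspace \<tau> = S"
    and card: "|\<T>| \<le>o \<kappa>" and wt: "\<And>\<tau>. \<tau> \<in> \<T> \<Longrightarrow> weight \<tau> \<le>o \<kappa>" and inf: "Cinfinite \<kappa>"
  shows "weight (join S \<T>) \<le>o \<kappa>"
proof -
  have "\<forall>\<tau> :: 'a topology. \<exists>b. base_of \<tau> b \<and> |b| \<le>o weight \<tau>"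
    by (meson obtain_weight_base)
  then obtain b where "\<forall>\<tau> :: 'a topology. base_of \<tau> (b \<tau>) \<and> |b \<tau>| \<le>o weight \<tau>"
    by (rule choice[THEN exE])
  then have b: "base_of \<tau> (b \<tau>)" "|b \<tau>| \<le>o weight \<tau>" for \<tau> by simp_all
  define \<G> where "\<G> = (\<Union>\<tau>\<in>\<T>. b \<tau>)"
  have sub: "G \<subseteq> S" if "G \<in> \<G>" for G
  proof -
    obtain \<tau> where \<tau>: "\<tau> \<in> \<T>" "G \<in> b \<tau>" using \<open>G \<in> \<G>\<close> by (auto simp: \<G>_def)
    then have "openin \<tau> G" using b(1) by (simp add: base_of_iff)
    then show ?thesis using top[OF \<tau>(1)] openin_subset by blast
  qed
  have "base_of (join S \<T>) (\<Union>n. finite_meets S \<G> n)"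
    unfolding base_of_iff
  proof (intro conjI ballI allI impI)
    have "openin (join S \<T>) G" if "G \<in> \<G>" for G
    proof -
      obtain \<tau> where \<tau>: "\<tau> \<in> \<T>" "G \<in> b \<tau>" using \<open>G \<in> \<G>\<close> by (auto simp: \<G>_def)
      then have "openin \<tau> G" using b(1) by (simp add: base_of_iff)
      then show ?thesis using \<tau>(1) openin_join_member by blast
    qed
    then have "\<forall>V\<in>finite_meets S \<G> n. openin (join S \<T>) V" for n
      by (induction n) (auto simp: openin_join_carrier)
    then show "openin (join S \<T>) V" if "V \<in> (\<Union>n. finite_meets S \<G> n)" for V
      using that by blast
  next
    fix U x assume "openin (join S \<T>) U \<and> x \<in> U"
    then have "openin (join S \<T>) U" "x \<in> U" by auto
    then show "\<exists>V\<in>\<Union>n. finite_meets S \<G> n. x \<in> V \<and> V \<subseteq> U"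
    proof (induction rule: join_induct)
      case carrier
      then show ?case by (auto intro!: exI[of _ 0])
    next
      case (member \<tau> U)
      then obtain V where "V \<in> b \<tau>" "x \<in> V" "V \<subseteq> U"
        using b(1)[of \<tau>] unfolding base_of_iff by meson
      moreover from this have "V \<in> \<G>" using member by (auto simp: \<G>_def)
      moreover from this have "V \<in> finite_meets S \<G> 1" using sub[of V] by auto
      then have "V \<in> (\<Union>n. finite_meets S \<G> n)" by (rule UN_I[OF UNIV_I])
      ultimately show ?case by (intro bexI[of _ V]) simp_all
    next
      case (Int U V)
      then have "x \<in> U" "x \<in> V" by auto
      with Int obtain A B m n where AB: "A \<in> finite_meets S \<G> m" "x \<in> A" "A \<subseteq> U"
        "B \<in> finite_meets S \<G> n" "x \<in> B" "B \<subseteq> V" by fast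
      then have "A \<inter> B \<in> finite_meets S \<G> (m + n)"
        by (intro finite_meets_Int sub)
      then have "A \<inter> B \<in> (\<Union>n. finite_meets S \<G> n)" by (rule UN_I[OF UNIV_I])
      then show ?case by (rule bexI[rotated]) (use AB in auto)
    next
      case (Union \<K>)
      then obtain U where U: "U \<in> \<K>" "x \<in> U" by auto
      with Union(2)[OF U(1)] obtain V where "V \<in> (\<Union>n. finite_meets S \<G> n)" "x \<in> V" "V \<subseteq> U"
        by auto
      then show ?case using U(1) by (intro bexI[of _ V]) auto
    qed
  qed
  moreover have "|\<G>| \<le>o \<kappa>"
    unfolding \<G>_def
    by (rule UNION_Cinfinite_bound[OF card _ inf])
      (intro ballI ordLeq_transitive[OF b(2)] wt)
  then have "|\<Union>n. finite_meets S \<G> n| \<le>o \<kappa>" using inf by (rule card_finite_meets)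
  ultimately show ?thesis
    using inf natLeq_ordLeq_cinfinite[OF inf] by (rule weight_le_if_base)
qed

section \<open>Lattices of coarser topologies\<close>

text \<open>
  Two points are topologically indistinguishable exactly if the Kolmogorov quotient identifies
  them. For the topology induced by a map, the classes are the fibres.
\<close>

abbreviation indist :: "'a topology \<Rightarrow> 'a \<Rightarrow> 'a \<Rightarrow> bool" where
  "indist \<tau> x y \<equiv> Kolmogorov_quotient \<tau> x = Kolmogorov_quotient \<tau> y"

definition saturated :: "'a topology \<Rightarrow> 'a set \<Rightarrow> bool" where
  "saturated \<tau> A \<longleftrightarrow> (\<forall>x\<in>A. \<forall>y\<in>topspace \<tau>. indist \<tau> x y \<longrightarrow> y \<in> A)"

definition saturation :: "'a topology \<Rightarrow> 'a set \<Rightarrow> 'a set" where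
  "saturation \<tau> A = {y \<in> topspace \<tau>. \<exists>x\<in>A. indist \<tau> x y}"

definition finer :: "'a topology \<Rightarrow> 'a topology \<Rightarrow> bool" where
  "finer \<tau> \<sigma> \<longleftrightarrow> topspace \<tau> = topspace \<sigma> \<and> (\<forall>U. openin \<sigma> U \<longrightarrow> openin \<tau> U)"

definition coarsening :: "'a topology \<Rightarrow> 'a topology \<Rightarrow> bool" where
  "coarsening X \<tau> \<longleftrightarrow> finer X \<tau> \<and> completely_regular_space \<tau>"

text \<open>
  If \<open>\<tau>\<close> is induced by a map \<open>\<phi>\<close>, the saturation of \<open>U\<close> is the preimage of the image of \<open>U\<close>, so
  this says that \<open>\<phi>\<close> is an open map onto its range.
\<close>

definition open_coarsening :: "'a topology \<Rightarrow> 'a topology \<Rightarrow> bool" where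
  "open_coarsening X \<tau> \<longleftrightarrow>
     coarsening X \<tau> \<and> (\<forall>U. openin X U \<longrightarrow> openin \<tau> (saturation \<tau> U))"

definition topology_lattice :: "'a topology \<Rightarrow> 'a topology set \<Rightarrow> bool" where
  "topology_lattice X \<L> \<longleftrightarrow>
     (\<forall>\<tau>\<in>\<L>. coarsening X \<tau>) \<and>
     (\<forall>\<sigma>. coarsening X \<sigma> \<longrightarrow> (\<exists>\<tau>\<in>\<L>. finer \<tau> \<sigma> \<and> weight \<tau> \<le>o weight \<sigma>)) \<and>
     (\<forall>\<T>\<subseteq>\<L>. join (topspace X) \<T> \<in> \<L>)"

lemma coarseningD:
  assumes "coarsening X \<tau>"
  shows "topspace \<tau> = topspace X" "openin \<tau> U \<Longrightarrow> openin X U" "completely_regular_space \<tau>"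
  using assms by (auto simp: coarsening_def finer_def)

lemma open_coarseningD:
  assumes "open_coarsening X \<tau>"
  shows "coarsening X \<tau>" "topspace \<tau> = topspace X"
    "openin X U \<Longrightarrow> openin \<tau> (saturation \<tau> U)" "openin X U \<Longrightarrow> openin X (saturation \<tau> U)"
  using assms coarseningD[of X \<tau>] by (auto simp: open_coarsening_def)

lemma topology_latticeD:
  assumes "topology_lattice X \<L>"
  shows "\<tau> \<in> \<L> \<Longrightarrow> coarsening X \<tau>"
    "coarsening X \<sigma> \<Longrightarrow> \<exists>\<tau>\<in>\<L>. finer \<tau> \<sigma> \<and> weight \<tau> \<le>o weight \<sigma>"
    "\<T> \<subseteq> \<L> \<Longrightarrow> join (topspace X) \<T> \<in> \<L>"
  using assms unfolding topology_lattice_def by simp_all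

lemma finer_refl: "finer \<tau> \<tau>"
  by (simp add: finer_def)

lemma finer_trans: "finer \<rho> \<tau> \<Longrightarrow> finer \<tau> \<sigma> \<Longrightarrow> finer \<rho> \<sigma>"
  by (simp add: finer_def)

lemma finerD: "finer \<tau> \<sigma> \<Longrightarrow> openin \<sigma> U \<Longrightarrow> openin \<tau> U"
  by (simp add: finer_def)

lemma finer_join:
  assumes "\<And>\<tau>. \<tau> \<in> \<T> \<Longrightarrow> topspace \<tau> = S" "\<tau> \<in> \<T>"
  shows "finer (join S \<T>) \<tau>"
  using assms topspace_join[of \<T> S] openin_join_member by (auto simp: finer_def)

lemma coarsening_join:
  assumes "\<And>\<tau>. \<tau> \<in> \<T> \<Longrightarrow> coarsening X \<tau>"
  shows "coarsening X (join (topspace X) \<T>)"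
proof -
  have top: "topspace \<tau> = topspace X" if "\<tau> \<in> \<T>" for \<tau>
    using assms[OF that] by (rule coarseningD)
  have "openin X U" if "openin (join (topspace X) \<T>) U" for U
    using that by (rule join_least) (auto dest: assms coarseningD(2))
  moreover have "completely_regular_space (join (topspace X) \<T>)"
    by (rule completely_regular_space_join) (auto dest: top assms coarseningD(3))
  ultimately show ?thesis
    using topspace_join[of \<T> "topspace X"] top by (simp add: coarsening_def finer_def)
qed

lemma indist_finer: "finer \<tau> \<sigma> \<Longrightarrow> indist \<tau> x y \<Longrightarrow> indist \<sigma> x y"
  by (simp add: Kolmogorov_quotient_eq finer_def)

lemma openin_imp_saturated: "openin \<tau> U \<Longrightarrow> saturated \<tau> U"
  by (auto simp: saturated_def Kolmogorov_quotient_eq)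

lemma saturated_finer: "finer \<tau> \<sigma> \<Longrightarrow> saturated \<sigma> A \<Longrightarrow> saturated \<tau> A"
  using indist_finer unfolding saturated_def by (metis finer_def)

lemma saturated_Union: "(\<And>A. A \<in> \<A> \<Longrightarrow> saturated \<tau> A) \<Longrightarrow> saturated \<tau> (\<Union>\<A>)"
  unfolding saturated_def by blast

lemma saturated_Int: "saturated \<tau> A \<Longrightarrow> saturated \<tau> B \<Longrightarrow> saturated \<tau> (A \<inter> B)"
  unfolding saturated_def by blast

lemma subset_saturation: "A \<subseteq> topspace \<tau> \<Longrightarrow> A \<subseteq> saturation \<tau> A"
  by (auto simp: saturation_def)

lemma saturation_subset: "saturated \<tau> B \<Longrightarrow> A \<subseteq> B \<Longrightarrow> saturation \<tau> A \<subseteq> B"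
  by (auto simp: saturation_def saturated_def)

text \<open>
  Preimages under an open map commute with closure: if a neighbourhood \<open>G\<close> of \<open>y\<close> is given, its
  saturation is a neighbourhood of every point indistinguishable from \<open>y\<close>.
\<close>

lemma saturated_closure:
  assumes \<tau>: "open_coarsening X \<tau>" and A: "saturated \<tau> A"
  shows "saturated \<tau> (X closure_of A)"
  unfolding saturated_def
proof (intro ballI impI)
  fix x y assume x: "x \<in> X closure_of A" and y: "y \<in> topspace \<tau>" "indist \<tau> x y"
  have "\<exists>a\<in>A. a \<in> G" if G: "openin X G" "y \<in> G" for G
  proof -
    have "x \<in> saturation \<tau> G"
      using x y G open_coarseningD(2)[OF \<tau>] by (auto simp: saturation_def in_closure_of)
    then obtain a where a: "a \<in> A" "a \<in> saturation \<tau> G"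
      using x open_coarseningD(4)[OF \<tau> G(1)] by (auto simp: in_closure_of)
    then obtain g where g: "g \<in> G" "indist \<tau> g a" by (auto simp: saturation_def)
    have "g \<in> topspace \<tau>"
      using g(1) G(1) openin_subset open_coarseningD(2)[OF \<tau>] by blast
    then have "g \<in> A"
      using A a(1) g(2) by (auto simp: saturated_def)
    with g(1) show ?thesis by blast
  qed
  then show "y \<in> X closure_of A"
    using y(1) open_coarseningD(2)[OF \<tau>] by (auto simp: in_closure_of)
qed

text \<open>
  The saturation of the interior is open and stays inside \<open>A\<close>.
\<close>

lemma saturated_interior:
  assumes \<tau>: "open_coarsening X \<tau>" and A: "saturated \<tau> A"
  shows "saturated \<tau> (X interior_of A)"
  unfolding saturated_def
proof (intro ballI impI)
  fix x y assume x: "x \<in> X interior_of A" and y: "y \<in> topspace \<tau>" "indist \<tau> x y"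
  let ?I = "saturation \<tau> (X interior_of A)"
  have "openin X ?I" using \<tau> by (rule open_coarseningD) (rule openin_interior_of)
  moreover have "?I \<subseteq> A" using A interior_of_subset by (rule saturation_subset)
  ultimately have "?I \<subseteq> X interior_of A" by (rule interior_of_maximal[rotated])
  moreover have "y \<in> ?I" using x y by (auto simp: saturation_def)
  ultimately show "y \<in> X interior_of A" by blast
qed

section \<open>The countable chain condition\<close>

text \<open>
  A form of the countable chain condition that can be used and transferred without choosing
  maximal disjoint families.
\<close>

definition ccc :: "'a topology \<Rightarrow> bool" where
  "ccc X \<longleftrightarrow> (\<forall>\<U>. (\<forall>U\<in>\<U>. openin X U) \<longrightarrow>
     (\<exists>\<V>\<subseteq>\<U>. countable \<V> \<and> \<Union>\<U> \<subseteq> X closure_of \<Union>\<V>))"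

lemma weight_euclidean_real: "weight euclideanreal \<le>o natLeq"
proof -
  obtain B :: "real set set" where B: "countable B" "topological_basis B"
    by (rule ex_countable_basis[THEN exE]) auto
  then have "base_of euclideanreal B"
    unfolding base_of_iff open_openin[symmetric]
    by (meson topological_basisE topological_basis_open)
  moreover have "|B| \<le>o natLeq" using B(1) by (simp add: countable_card_le_natLeq)
  ultimately show ?thesis
    using natLeq_Cinfinite ordLeq_refl[OF natLeq_Card_order] by (rule weight_le_if_base)
qed

text \<open>
  Complete regularity yields a function that separates \<open>x\<close> from the complement of \<open>U\<close>; the
  topology it induces inherits a countable base from the real line.
\<close>

lemma countable_weight_neighbourhood:
  assumes X: "completely_regular_space X" and U: "openin X U" "x \<in> U"
  shows "\<exists>\<sigma> C. coarsening X \<sigma> \<and> weight \<sigma> \<le>o natLeq \<and> openin \<sigma> C \<and> x \<in> C \<and> C \<subseteq> U"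
proof -
  obtain f where f: "continuous_map X euclideanreal f" "f x = 0" "f ` (topspace X - U) \<subseteq> {1}"
    using X U unfolding completely_regular_space_alt' by blast
  let ?\<sigma> = "pullback_topology (topspace X) f euclideanreal"
  let ?C = "f -` {..<1} \<inter> topspace X"
  have "openin X V" if V: "openin ?\<sigma> V" for V
  proof -
    obtain W where "open W" "V = f -` W \<inter> topspace X"
      using V by (auto simp: openin_pullback_topology)
    then have "openin X {x \<in> topspace X. f x \<in> W}" "V = {x \<in> topspace X. f x \<in> W}"
      using openin_continuous_map_preimage[OF f(1)] by auto
    then show ?thesis by simp
  qed
  moreover have "completely_regular_space ?\<sigma>"
    by (rule completely_regular_space_pullback)
      (auto intro: metrizable_imp_completely_regular_space metrizable_space_euclidean)
  ultimately have "coarsening X ?\<sigma>"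
    by (auto simp: coarsening_def finer_def topspace_pullback_topology)
  moreover have "weight ?\<sigma> \<le>o natLeq"
    by (rule ordLeq_transitive[OF weight_pullback_le weight_euclidean_real])
  moreover have "openin ?\<sigma> ?C"
    unfolding openin_pullback_topology by (intro exI[of _ "{..<1}"]) auto
  moreover have "x \<in> ?C" using f(2) U openin_subset by auto
  moreover have "?C \<subseteq> U" using f(3) by auto
  ultimately show ?thesis by blast
qed

text \<open>
  By the chain condition countably many cozero sets exhaust \<open>U\<close> up to closure, and the join of
  the countably many topologies that they come from still has countable weight.
\<close>

lemma countable_weight_dense_open:
  assumes X: "completely_regular_space X" "ccc X" and U: "openin X U"
  shows "\<exists>\<sigma> W. coarsening X \<sigma> \<and> weight \<sigma> \<le>o natLeq \<and> openin \<sigma> W \<and> W \<subseteq> U \<and> U \<subseteq> X closure_of W"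
proof -
  define \<U> where "\<U> = {C. C \<subseteq> U \<and> (\<exists>\<sigma>. coarsening X \<sigma> \<and> weight \<sigma> \<le>o natLeq \<and> openin \<sigma> C)}"
  have "\<forall>C\<in>\<U>. openin X C" unfolding \<U>_def using coarseningD(2) by blast
  then obtain \<V> where \<V>: "\<V> \<subseteq> \<U>" "countable \<V>" "\<Union>\<U> \<subseteq> X closure_of \<Union>\<V>"
    using X(2) unfolding ccc_def by meson
  have "\<forall>C\<in>\<V>. \<exists>\<sigma>. coarsening X \<sigma> \<and> weight \<sigma> \<le>o natLeq \<and> openin \<sigma> C"
    using \<V>(1) unfolding \<U>_def by blast
  then obtain s where s: "\<And>C. C \<in> \<V> \<Longrightarrow> coarsening X (s C)"
    "\<And>C. C \<in> \<V> \<Longrightarrow> weight (s C) \<le>o natLeq" "\<And>C. C \<in> \<V> \<Longrightarrow> openin (s C) C"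
    unfolding bchoice_iff by blast
  let ?\<sigma> = "join (topspace X) (s ` \<V>)"
  have "coarsening X ?\<sigma>" using s(1) by (intro coarsening_join) auto
  moreover have "|\<V>| \<le>o natLeq" using \<V>(2) by (simp add: countable_card_le_natLeq)
  then have "|s ` \<V>| \<le>o natLeq" by (rule ordLeq_transitive[OF card_of_image])
  then have "weight ?\<sigma> \<le>o natLeq"
    using s(1,2) by (intro weight_join_le natLeq_Cinfinite) (auto dest: coarseningD(1))
  moreover have "openin ?\<sigma> (\<Union>\<V>)"
    using s(3) by (intro openin_Union) (auto intro: openin_join_member)
  moreover have "\<Union>\<V> \<subseteq> U" using \<V>(1) by (auto simp: \<U>_def)
  moreover have "U \<subseteq> \<Union>\<U>"
  proof
    fix x assume "x \<in> U"
    from countable_weight_neighbourhood[OF X(1) U this]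
    show "x \<in> \<Union>\<U>" unfolding \<U>_def by blast
  qed
  then have "U \<subseteq> X closure_of \<Union>\<V>" using \<V>(3) by (rule subset_trans)
  ultimately show ?thesis by blast
qed

lemma join_chain_base:
  assumes top: "\<And>n. topspace (\<tau> n) = S" and chain: "\<And>n. finer (\<tau> (Suc n)) (\<tau> n)"
    and U: "openin (join S (range \<tau>)) U" "x \<in> U"
  shows "\<exists>n V. openin (\<tau> n) V \<and> x \<in> V \<and> V \<subseteq> U"
proof -
  have mono: "finer (\<tau> n) (\<tau> m)" if "m \<le> n" for m n
    using that by (induction rule: dec_induct) (auto intro: finer_refl finer_trans chain)
  from U show ?thesis
  proof (induction rule: join_induct)
    case carrier
    have "openin (\<tau> 0) S" using top[of 0] by (metis openin_topspace)
    then show ?case using carrier by blast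
  next
    case (member \<tau>' U)
    then show ?case by auto
  next
    case (Int U V)
    then obtain m A n B where A: "openin (\<tau> m) A" "x \<in> A" "A \<subseteq> U"
      and B: "openin (\<tau> n) B" "x \<in> B" "B \<subseteq> V" by auto
    have "openin (\<tau> (max m n)) A" "openin (\<tau> (max m n)) B"
      using A(1) B(1) finerD mono by (metis max.cobounded1, metis max.cobounded2)
    then have "openin (\<tau> (max m n)) (A \<inter> B)" by blast
    then show ?case using A B by (intro exI[of _ "max m n"] exI[of _ "A \<inter> B"]) auto
  next
    case (Union \<K>)
    then obtain K where K: "K \<in> \<K>" "x \<in> K" by auto
    then obtain n V where "openin (\<tau> n) V" "x \<in> V" "V \<subseteq> K" using Union(2)[OF K] by auto
    then show ?case using K(1) by (intro exI[of _ n] exI[of _ V]) auto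
  qed
qed

text \<open>
  One step of the closing-off argument behind the chain condition: \<open>\<tau>\<close> is refined inside the
  lattice so that each of its countably many basic sets meets an open set of the refinement
  which lies in a member of \<open>\<D>\<close>.
\<close>

lemma countable_weight_step:
  assumes X: "completely_regular_space X" and L: "topology_lattice X \<L>"
    and D: "\<forall>D\<in>\<D>. openin X D" "\<forall>H. openin X H \<and> H \<noteq> {} \<longrightarrow> (\<exists>D\<in>\<D>. D \<inter> H \<noteq> {})"
    and \<tau>: "\<tau> \<in> \<L>" "weight \<tau> \<le>o natLeq"
  shows "\<exists>\<tau>' \<V>. \<tau>' \<in> \<L> \<and> weight \<tau>' \<le>o natLeq \<and> finer \<tau>' \<tau> \<and> countable \<V> \<and>
           (\<forall>C\<in>\<V>. openin \<tau>' C \<and> (\<exists>D\<in>\<D>. C \<subseteq> D)) \<and>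
           (\<forall>V. openin \<tau> V \<and> V \<noteq> {} \<longrightarrow> (\<exists>C\<in>\<V>. C \<inter> V \<noteq> {}))"
proof -
  have co: "coarsening X \<rho>" if "\<rho> \<in> \<L>" for \<rho> using L that by (rule topology_latticeD)
  obtain b where b: "base_of \<tau> b" "|b| \<le>o weight \<tau>" by (rule obtain_weight_base)
  let ?b = "b - {{}}"
  have "\<exists>\<rho> C. \<rho> \<in> \<L> \<and> weight \<rho> \<le>o natLeq \<and> openin \<rho> C \<and> C \<inter> V \<noteq> {} \<and> (\<exists>D\<in>\<D>. C \<subseteq> D)"
    if V: "V \<in> ?b" for V
  proof -
    have "openin X V" using V b(1) coarseningD(2)[OF co[OF \<tau>(1)]] by (auto simp: base_of_iff)
    then obtain D where "D \<in> \<D>" "D \<inter> V \<noteq> {}" using D(2) V by auto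
    then obtain x where x: "openin X D" "x \<in> D" "x \<in> V" using D(1) by auto
    obtain \<sigma> C where \<sigma>: "coarsening X \<sigma>" "weight \<sigma> \<le>o natLeq" "openin \<sigma> C" "x \<in> C" "C \<subseteq> D"
      using countable_weight_neighbourhood[OF X x(1,2)] by blast
    then obtain \<rho> where "\<rho> \<in> \<L>" "finer \<rho> \<sigma>" "weight \<rho> \<le>o weight \<sigma>"
      using topology_latticeD(2)[OF L] by blast
    moreover from this have "weight \<rho> \<le>o natLeq" using \<sigma>(2) ordLeq_transitive by blast
    ultimately show ?thesis
      using \<sigma> x(3) \<open>D \<in> \<D>\<close> finerD by (intro exI[of _ \<rho>] exI[of _ C]) auto
  qed
  then have "\<forall>V\<in>?b. \<exists>z. fst z \<in> \<L> \<and> weight (fst z) \<le>o natLeq \<and> openin (fst z) (snd z) \<and>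
      snd z \<inter> V \<noteq> {} \<and> (\<exists>D\<in>\<D>. snd z \<subseteq> D)"
    by simp
  then obtain z where z': "\<forall>V\<in>?b. fst (z V) \<in> \<L> \<and> weight (fst (z V)) \<le>o natLeq \<and>
      openin (fst (z V)) (snd (z V)) \<and> snd (z V) \<inter> V \<noteq> {} \<and> (\<exists>D\<in>\<D>. snd (z V) \<subseteq> D)"
    by (rule bchoice[THEN exE])
  have z: "fst (z V) \<in> \<L>" "weight (fst (z V)) \<le>o natLeq" "openin (fst (z V)) (snd (z V))"
      "snd (z V) \<inter> V \<noteq> {}" "\<exists>D\<in>\<D>. snd (z V) \<subseteq> D" if "V \<in> ?b" for V
    using bspec[OF z' that] by simp_all
  let ?T = "insert \<tau> ((\<lambda>V. fst (z V)) ` ?b)"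
  let ?\<tau> = "join (topspace X) ?T"
  let ?V = "(\<lambda>V. snd (z V)) ` ?b"
  have TL: "?T \<subseteq> \<L>" using \<tau>(1) z(1) by auto
  then have top: "topspace \<rho> = topspace X" if "\<rho> \<in> ?T" for \<rho>
    using that co coarseningD(1) by blast
  have "countable b"
    using ordLeq_transitive[OF b(2) \<tau>(2)] by (simp add: countable_card_le_natLeq)
  then have cb: "countable ?b" by auto
  have "?\<tau> \<in> \<L>" using L TL by (rule topology_latticeD)
  moreover have "|?T| \<le>o natLeq"
    using cb by (simp add: countable_card_le_natLeq[symmetric])
  then have "weight ?\<tau> \<le>o natLeq"
    by (intro weight_join_le natLeq_Cinfinite) (use top \<tau>(2) z(2) in auto)
  moreover have "finer ?\<tau> \<tau>" by (rule finer_join) (use top in auto)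
  moreover have "countable ?V" using cb by auto
  moreover have "\<forall>C\<in>?V. openin ?\<tau> C \<and> (\<exists>D\<in>\<D>. C \<subseteq> D)"
  proof
    fix C assume "C \<in> ?V"
    then obtain V where V: "V \<in> ?b" "C = snd (z V)" by blast
    then show "openin ?\<tau> C \<and> (\<exists>D\<in>\<D>. C \<subseteq> D)"
      using z(3,5)[OF V(1)] openin_join_member[of "fst (z V)" ?T C "topspace X"] by auto
  qed
  moreover have "\<forall>V. openin \<tau> V \<and> V \<noteq> {} \<longrightarrow> (\<exists>C\<in>?V. C \<inter> V \<noteq> {})"
  proof (intro allI impI, elim conjE)
    fix V assume V: "openin \<tau> V" "V \<noteq> {}"
    obtain x where "x \<in> V" using V(2) by blast
    then obtain B where B: "B \<in> b" "x \<in> B" "B \<subseteq> V" using b(1) V(1) unfolding base_of_iff by meson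
    then have Bb: "B \<in> ?b" by auto
    then have "snd (z B) \<inter> V \<noteq> {}" using z(4)[of B] B(3) by blast
    then show "\<exists>C\<in>?V. C \<inter> V \<noteq> {}" using Bb by (intro bexI[of _ "snd (z B)"]) auto
  qed
  ultimately show ?thesis
    by (intro exI[of _ ?\<tau>] exI[of _ ?V] conjI)
qed

text \<open>
  Iterate the step and let \<open>\<tau>\<close> be the join, which belongs to the lattice. An open set \<open>H\<close> has a
  \<open>\<tau>\<close>-open saturation, which contains an open set of a finite stage and therefore meets a chosen
  \<open>C\<close> of the next stage. Since \<open>C\<close> is \<open>\<tau>\<close>-open, hence saturated, it meets \<open>H\<close> itself.
\<close>

lemma open_lattice_countable_dense_subfamily:
  assumes X: "completely_regular_space X" and L: "topology_lattice X \<L>"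
    and op: "\<forall>\<tau>\<in>\<L>. open_coarsening X \<tau>"
    and D: "\<forall>D\<in>\<D>. openin X D" "\<forall>H. openin X H \<and> H \<noteq> {} \<longrightarrow> (\<exists>D\<in>\<D>. D \<inter> H \<noteq> {})"
  shows "\<exists>\<E>\<subseteq>\<D>. countable \<E> \<and> (\<forall>H. openin X H \<and> H \<noteq> {} \<longrightarrow> (\<exists>D\<in>\<E>. D \<inter> H \<noteq> {}))"
proof -
  let ?P = "\<lambda>\<tau>. \<tau> \<in> \<L> \<and> weight \<tau> \<le>o natLeq"
  let ?Q = "\<lambda>\<tau> \<tau>' \<V>. finer \<tau>' \<tau> \<and> countable \<V> \<and>
         (\<forall>C\<in>\<V>. openin \<tau>' C \<and> (\<exists>D\<in>\<D>. C \<subseteq> D)) \<and>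
         (\<forall>V. openin \<tau> V \<and> V \<noteq> {} \<longrightarrow> (\<exists>C\<in>\<V>. C \<inter> V \<noteq> {}))"
  have "\<exists>f. \<forall>n :: nat. ?P (f n) \<and> (\<exists>\<V>. ?Q (f n) (f (Suc n)) \<V>)"
  proof (rule dependent_nat_choice)
    have "|{} :: 'a topology set| \<le>o natLeq"
      using countable_card_le_natLeq countable_empty by blast
    then have "weight (join (topspace X) {}) \<le>o natLeq"
      by (intro weight_join_le natLeq_Cinfinite) auto
    moreover have "join (topspace X) {} \<in> \<L>" by (rule topology_latticeD[OF L]) simp
    ultimately show "\<exists>\<tau>. ?P \<tau>" by blast
  next
    fix \<tau> and n :: nat assume "?P \<tau>"
    then have "\<tau> \<in> \<L>" "weight \<tau> \<le>o natLeq" by auto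
    from countable_weight_step[OF X L D this]
    show "\<exists>\<tau>'. ?P \<tau>' \<and> (\<exists>\<V>. ?Q \<tau> \<tau>' \<V>)" by metis
  qed
  then obtain t where t: "\<And>n :: nat. ?P (t n)" "\<forall>n. \<exists>\<V>. ?Q (t n) (t (Suc n)) \<V>"
    by auto
  from t(2) obtain \<V> where \<V>: "\<forall>n. ?Q (t n) (t (Suc n)) (\<V> n)"
    by (rule choice[THEN exE])
  let ?t = "join (topspace X) (range t)"
  have top: "topspace (t n) = topspace X" for n
    using topology_latticeD(1)[OF L] t(1)[of n] coarseningD(1) by blast
  have "range t \<subseteq> \<L>" using t(1) by auto
  with L have "?t \<in> \<L>" by (rule topology_latticeD)
  with op have opt: "open_coarsening X ?t" by blast
  have meets: "\<exists>C\<in>(\<Union>n. \<V> n). C \<inter> H \<noteq> {}" if H: "openin X H" "H \<noteq> {}" for H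
  proof -
    have "H \<subseteq> saturation ?t H"
      by (rule subset_saturation) (use H(1) openin_subset open_coarseningD(2)[OF opt] in auto)
    then obtain x where x: "x \<in> saturation ?t H" using H(2) by blast
    have "openin ?t (saturation ?t H)" using opt H(1) by (rule open_coarseningD)
    from join_chain_base[OF top _ this x] \<V>
    obtain n V where V: "openin (t n) V" "x \<in> V" "V \<subseteq> saturation ?t H" by blast
    then have "V \<noteq> {}" by blast
    with V(1) \<V>[rule_format, of n] obtain C where C: "C \<in> \<V> n" "C \<inter> V \<noteq> {}" by blast
    then obtain y where y: "y \<in> C" "y \<in> saturation ?t H" using V(3) by blast
    then obtain z where z: "z \<in> H" "indist ?t z y" by (auto simp: saturation_def)
    have "openin (t (Suc n)) C" using \<V>[rule_format, of n] C(1) by blast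
    then have "openin ?t C" by (rule openin_join_member[rotated]) auto
    then have "z \<in> C" using y(1) z(2) by (auto simp: Kolmogorov_quotient_eq)
    then show ?thesis using C(1) z(1) by blast
  qed
  have "\<forall>C\<in>(\<Union>n. \<V> n). \<exists>D. D \<in> \<D> \<and> C \<subseteq> D" using \<V> by blast
  then obtain d where d: "\<And>C. C \<in> (\<Union>n. \<V> n) \<Longrightarrow> d C \<in> \<D> \<and> C \<subseteq> d C"
    unfolding bchoice_iff by blast
  show ?thesis
  proof (intro exI conjI allI impI)
    show "d ` (\<Union>n. \<V> n) \<subseteq> \<D>" using d by blast
    show "countable (d ` (\<Union>n. \<V> n))" using \<V> by auto
    fix H assume "openin X H \<and> H \<noteq> {}"
    then obtain C where "C \<in> (\<Union>n. \<V> n)" "C \<inter> H \<noteq> {}" using meets by blast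
    then show "\<exists>D\<in>d ` (\<Union>n. \<V> n). D \<inter> H \<noteq> {}" using d by blast
  qed
qed

text \<open>
  Adding the exterior of \<open>\<Union>\<U>\<close> to \<open>\<U>\<close> produces a family with dense union.
\<close>

lemma open_lattice_imp_ccc:
  assumes X: "completely_regular_space X" and L: "topology_lattice X \<L>"
    and op: "\<forall>\<tau>\<in>\<L>. open_coarsening X \<tau>"
  shows "ccc X"
proof -
  show ?thesis
    unfolding ccc_def
  proof (intro allI impI)
    fix \<U> assume U: "\<forall>U\<in>\<U>. openin X U"
    let ?D = "insert (topspace X - X closure_of \<Union>\<U>) \<U>"
    have D1: "\<forall>D\<in>?D. openin X D" using U by auto
    have D2: "\<forall>H. openin X H \<and> H \<noteq> {} \<longrightarrow> (\<exists>D\<in>?D. D \<inter> H \<noteq> {})"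
    proof (intro allI impI, elim conjE)
      fix H assume H: "openin X H" "H \<noteq> {}"
      show "\<exists>D\<in>?D. D \<inter> H \<noteq> {}"
      proof (cases "H \<inter> \<Union>\<U> = {}")
        case True
        then have "H \<inter> X closure_of \<Union>\<U> = {}" using H(1) by (simp add: openin_Int_closure_of_eq_empty)
        then have "(topspace X - X closure_of \<Union>\<U>) \<inter> H \<noteq> {}"
          using H(2) openin_subset[OF H(1)] by fast
        then show ?thesis by (rule bexI) simp
      next
        case False
        then obtain D where "D \<in> \<U>" "D \<inter> H \<noteq> {}" by blast
        then show ?thesis by (intro bexI[of _ D]) simp_all
      qed
    qed
    from open_lattice_countable_dense_subfamily[OF X L op D1 D2]
    obtain \<E> where E: "\<E> \<subseteq> ?D" "countable \<E>"
        "\<forall>H. openin X H \<and> H \<noteq> {} \<longrightarrow> (\<exists>D\<in>\<E>. D \<inter> H \<noteq> {})"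
      by (elim exE conjE) (rule that)
    have "\<Union>\<U> \<subseteq> X closure_of \<Union>(\<E> \<inter> \<U>)"
    proof
      fix x assume x: "x \<in> \<Union>\<U>"
      have "\<exists>y. y \<in> \<Union>(\<E> \<inter> \<U>) \<and> y \<in> G" if G: "openin X G" "x \<in> G" for G
      proof -
        have op: "openin X (\<Union>\<U>)" using U by blast
        have "openin X (G \<inter> \<Union>\<U>)" "G \<inter> \<Union>\<U> \<noteq> {}" using G x op by auto
        then obtain D where D: "D \<in> \<E>" "D \<inter> (G \<inter> \<Union>\<U>) \<noteq> {}" using E(3) by blast
        have "\<Union>\<U> \<subseteq> X closure_of \<Union>\<U>" using closure_of_subset[OF openin_subset[OF op]] .
        then have "D \<noteq> topspace X - X closure_of \<Union>\<U>" using D(2) by blast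
        then have "D \<in> \<U>" using D(1) E(1) by blast
        then show ?thesis using D by blast
      qed
      moreover have "x \<in> topspace X" using x U openin_subset by blast
      ultimately show "x \<in> X closure_of \<Union>(\<E> \<inter> \<U>)" by (simp add: in_closure_of)
    qed
    then show "\<exists>\<V>\<subseteq>\<U>. countable \<V> \<and> \<Union>\<U> \<subseteq> X closure_of \<Union>\<V>"
      using E(2) by (intro exI[of _ "\<E> \<inter> \<U>"]) auto
  qed
qed

text \<open>
  A dense subset \<open>W\<close> of \<open>U\<close> that is open in some \<open>\<tau>\<close> of the lattice is saturated, hence so is
  its closure, which is the closure of \<open>U\<close>.
\<close>

lemma countable_weight_saturating:
  assumes X: "completely_regular_space X" and L: "topology_lattice X \<L>"
    and op: "\<forall>\<tau>\<in>\<L>. open_coarsening X \<tau>" and U: "openin X U"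
  shows "\<exists>\<tau>\<in>\<L>. weight \<tau> \<le>o natLeq \<and> saturated \<tau> (X closure_of U)"
proof -
  have "ccc X" using X L op by (rule open_lattice_imp_ccc)
  then obtain \<sigma> W where \<sigma>: "coarsening X \<sigma>" "weight \<sigma> \<le>o natLeq" "openin \<sigma> W"
      "W \<subseteq> U" "U \<subseteq> X closure_of W"
    using countable_weight_dense_open[OF X _ U] by blast
  then obtain \<tau> where \<tau>: "\<tau> \<in> \<L>" "finer \<tau> \<sigma>" "weight \<tau> \<le>o weight \<sigma>"
    using topology_latticeD(2)[OF L] by blast
  have "X closure_of W = X closure_of U"
    by (intro subset_antisym closure_of_mono closure_of_minimal \<sigma>(4,5) closedin_closure_of)
  moreover have "saturated \<tau> W" by (rule openin_imp_saturated[OF finerD[OF \<tau>(2) \<sigma>(3)]])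
  then have "saturated \<tau> (X closure_of W)" using bspec[OF op \<tau>(1)] by (rule saturated_closure[rotated])
  ultimately show ?thesis using \<tau> \<sigma>(2) ordLeq_transitive by metis
qed

section \<open>Transfer of open sets between co-absolute spaces\<close>

lemma closure_of_meets:
  assumes "x \<in> X closure_of A" "openin X G" "x \<in> G"
  obtains y where "y \<in> A" "y \<in> G"
  using assms unfolding in_closure_of by blast


definition closed_irreducible :: "'e topology \<Rightarrow> 'a topology \<Rightarrow> ('e \<Rightarrow> 'a) \<Rightarrow> bool" where
  "closed_irreducible E X p \<longleftrightarrow> continuous_map E X p \<and> closed_map E X p \<and> irreducible_map E X p"

text \<open>
  The largest subset of \<open>X\<close> whose preimage in \<open>E\<close> is mapped into \<open>V\<close>.
\<close>

definition transfer ::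
    "'e topology \<Rightarrow> 'a topology \<Rightarrow> ('e \<Rightarrow> 'a) \<Rightarrow> ('e \<Rightarrow> 'b) \<Rightarrow> 'b set \<Rightarrow> 'a set" where
  "transfer E X p q V = {x \<in> topspace X. \<forall>e\<in>topspace E. p e = x \<longrightarrow> q e \<in> V}"

lemma closed_irreducibleD:
  assumes "closed_irreducible E X p"
  shows "continuous_map E X p" "closed_map E X p" "p ` topspace E = topspace X"
    "e \<in> topspace E \<Longrightarrow> p e \<in> topspace X"
  using assms by (auto simp: closed_irreducible_def irreducible_map_def)

text \<open>
  The set \<open>K\<close> is the complement of the image of the closed set \<open>E - N\<close>. Closedness of the map
  makes it open, irreducibility makes it nonempty if \<open>N\<close> is.
\<close>

lemma closed_irreducible_core:
  assumes p: "closed_irreducible E X p" and N: "openin E N"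
  defines "K \<equiv> {x \<in> topspace X. \<forall>e\<in>topspace E. p e = x \<longrightarrow> e \<in> N}"
  shows "openin X K" "N \<noteq> {} \<Longrightarrow> K \<noteq> {}"
proof -
  let ?C = "topspace E - N"
  have K: "K = topspace X - p ` ?C" unfolding K_def by auto
  have C: "closedin E ?C" using N by blast
  then have "closedin X (p ` ?C)"
    using closed_irreducibleD(2)[OF p] by (simp add: closed_map_def)
  then show "openin X K" unfolding K by blast
  assume "N \<noteq> {}"
  then have "?C \<noteq> topspace E" using openin_subset[OF N] by blast
  then have "p ` ?C \<noteq> topspace X"
    using p C by (auto simp: closed_irreducible_def irreducible_map_def)
  moreover have "p ` ?C \<subseteq> topspace X" using closed_irreducibleD(3)[OF p] by blast
  ultimately show "K \<noteq> {}" unfolding K by blast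
qed

lemma closed_irreducible_comp_homeomorphic:
  assumes h: "homeomorphic_map E' E h" and p: "closed_irreducible E X p"
  shows "closed_irreducible E' X (p \<circ> h)"
  unfolding closed_irreducible_def
proof (intro conjI)
  have him: "h ` topspace E' = topspace E" using h by (rule homeomorphic_imp_surjective_map)
  show "continuous_map E' X (p \<circ> h)"
    using homeomorphic_imp_continuous_map[OF h] closed_irreducibleD(1)[OF p]
    by (rule continuous_map_compose)
  show "closed_map E' X (p \<circ> h)"
    using homeomorphic_imp_closed_map[OF h] closed_irreducibleD(2)[OF p]
    by (rule closed_map_compose)
  show "irreducible_map E' X (p \<circ> h)"
    unfolding irreducible_map_def
  proof (intro conjI allI impI)
    show "(p \<circ> h) ` topspace E' = topspace X"
      unfolding image_comp[symmetric] him by (rule closed_irreducibleD(3)[OF p])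
    fix C assume C: "closedin E' C \<and> C \<noteq> topspace E'"
    then have sub: "C \<subseteq> topspace E'" using closedin_subset by blast
    have "closedin E (h ` C)"
      using homeomorphic_imp_closed_map[OF h] C unfolding closed_map_def by blast
    moreover have "h ` C \<noteq> h ` topspace E'"
      using C sub inj_on_image_eq_iff[OF homeomorphic_imp_injective_map[OF h] sub order_refl] by blast
    ultimately have "p ` h ` C \<noteq> topspace X"
      using p him unfolding closed_irreducible_def irreducible_map_def by metis
    then show "(p \<circ> h) ` C \<noteq> topspace X" unfolding image_comp[symmetric] .
  qed
qed

text \<open>
  The conclusion is phrased with a closure so that finitely many such sets \<open>V\<close> can be combined.
\<close>

lemma regular_separation:
  assumes reg: "regular_space \<sigma>" and y: "y \<in> topspace \<sigma>" "z \<in> topspace \<sigma>" "\<not> indist \<sigma> z y"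
  shows "\<exists>V. openin \<sigma> V \<and> z \<in> V \<and> y \<notin> \<sigma> closure_of V"
proof -
  have *: "\<exists>U V. openin \<sigma> U \<and> openin \<sigma> V \<and> a \<in> U \<and> b \<in> V \<and> U \<inter> V = {}"
    if a: "openin \<sigma> G" "a \<in> G" "b \<in> topspace \<sigma>" "b \<notin> G" for a b G
  proof -
    have "closedin \<sigma> (topspace \<sigma> - G)" using a(1) by blast
    moreover have "a \<in> topspace \<sigma> - (topspace \<sigma> - G)" using a(1,2) openin_subset by blast
    ultimately obtain U V where "openin \<sigma> U" "openin \<sigma> V" "a \<in> U" "topspace \<sigma> - G \<subseteq> V" "disjnt U V"
      using reg unfolding regular_space_def by meson
    then show ?thesis using a(3,4) unfolding disjnt_def by blast
  qed
  obtain G where "openin \<sigma> G" "z \<in> G \<longleftrightarrow> y \<notin> G"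
    using y(3) unfolding Kolmogorov_quotient_eq by blast
  then obtain U V where UV: "openin \<sigma> U" "openin \<sigma> V" "y \<in> U" "z \<in> V" "U \<inter> V = {}"
    using *[of G y z] *[of G z y] y(1,2) by blast
  then have "U \<inter> \<sigma> closure_of V = {}" by (simp add: openin_Int_closure_of_eq_empty)
  then show ?thesis using UV by blast
qed

lemma card_range_nat: "natLeq \<le>o \<kappa> \<Longrightarrow> |range (f :: nat \<Rightarrow> 'z)| \<le>o \<kappa>"
  using countable_card_le_natLeq[of "range f"] ordLeq_transitive by auto

text \<open>
  The common absolute with its two maps. The situation is symmetric in \<open>X\<close> and \<open>Y\<close>, so that each
  result about \<open>to_X\<close> also holds for \<open>to_Y\<close> by interpreting the locale with the roles exchanged.
\<close>

locale roof =
  fixes E :: "'e topology" and X :: "'a topology" and Y :: "'b topology"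
    and p :: "'e \<Rightarrow> 'a" and q :: "'e \<Rightarrow> 'b"
  assumes p: "closed_irreducible E X p" and q: "closed_irreducible E Y q"
begin

abbreviation to_X :: "'b set \<Rightarrow> 'a set" where "to_X \<equiv> transfer E X p q"
abbreviation to_Y :: "'a set \<Rightarrow> 'b set" where "to_Y \<equiv> transfer E Y q p"

lemma swap: "roof E Y X q p"
  using p q by (simp add: roof_def)

lemma openin_preimage: "openin Y V \<Longrightarrow> openin E {e \<in> topspace E. q e \<in> V}"
  using closed_irreducibleD(1)[OF q] by (rule openin_continuous_map_preimage)

lemma to_X_core: "to_X V = {x \<in> topspace X. \<forall>e\<in>topspace E. p e = x \<longrightarrow> e \<in> {e \<in> topspace E. q e \<in> V}}"
  unfolding transfer_def by auto

lemma openin_to_X: "openin Y V \<Longrightarrow> openin X (to_X V)"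
  unfolding to_X_core by (rule closed_irreducible_core(1)[OF p openin_preimage])

lemma to_X_nonempty:
  assumes "openin Y V" "V \<noteq> {}"
  shows "to_X V \<noteq> {}"
  unfolding to_X_core
proof (rule closed_irreducible_core(2)[OF p openin_preimage[OF assms(1)]])
  obtain y where "y \<in> V" "y \<in> topspace Y" using assms openin_subset[OF assms(1)] by blast
  moreover from this obtain e where "e \<in> topspace E" "q e = y"
    using closed_irreducibleD(3)[OF q] by (metis imageE)
  ultimately show "{e \<in> topspace E. q e \<in> V} \<noteq> {}" by blast
qed

lemma to_X_Int: "to_X (V \<inter> W) = to_X V \<inter> to_X W"
  unfolding transfer_def by blast

lemma to_X_mono: "V \<subseteq> W \<Longrightarrow> to_X V \<subseteq> to_X W"
  unfolding transfer_def by blast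

lemma to_X_topspace: "to_X (topspace Y) = topspace X"
  using closed_irreducibleD(4)[OF q] unfolding transfer_def by auto

lemma to_X_subset: "to_X V \<subseteq> topspace X"
  unfolding transfer_def by auto

lemma obtain_preimage:
  assumes "x \<in> topspace X"
  obtains e where "e \<in> topspace E" "p e = x"
  using assms closed_irreducibleD(3)[OF p] by (metis imageE)

lemma to_X_empty: "to_X {} = {}"
proof -
  have "x \<notin> to_X {}" for x
  proof
    assume x: "x \<in> to_X {}"
    then have "x \<in> topspace X" by (simp add: transfer_def)
    then obtain e where "e \<in> topspace E" "p e = x" by (rule obtain_preimage)
    then show False using x by (simp add: transfer_def)
  qed
  then show ?thesis by blast
qed

text \<open>
  The set \<open>to_X V\<close> is smaller than the image of the preimage of \<open>V\<close>, but dense in it: a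
  neighbourhood \<open>G\<close> of \<open>p e\<close> gives the nonempty open set \<open>q\<inverse>(V) \<inter> p\<inverse>(G)\<close>, which contains a full
  fibre of \<open>p\<close>.
\<close>

lemma image_in_closure_to_X:
  assumes V: "openin Y V" and e: "e \<in> topspace E" "q e \<in> V"
  shows "p e \<in> X closure_of (to_X V)"
  unfolding in_closure_of
proof (intro conjI allI impI)
  show "p e \<in> topspace X" using closed_irreducibleD(4)[OF p e(1)] .
  fix G assume G: "p e \<in> G \<and> openin X G"
  let ?N = "{e \<in> topspace E. q e \<in> V} \<inter> {e \<in> topspace E. p e \<in> G}"
  have "openin E {e \<in> topspace E. p e \<in> G}"
    using closed_irreducibleD(1)[OF p] G by (intro openin_continuous_map_preimage) auto
  then have N: "openin E ?N" using openin_preimage[OF V] by blast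
  have "e \<in> ?N" using e G by simp
  then have "{x \<in> topspace X. \<forall>e\<in>topspace E. p e = x \<longrightarrow> e \<in> ?N} \<noteq> {}"
    by (intro closed_irreducible_core(2)[OF p N]) blast
  then obtain x where x: "x \<in> topspace X" "\<And>e. e \<in> topspace E \<Longrightarrow> p e = x \<Longrightarrow> e \<in> ?N"
    by blast
  obtain d where d: "d \<in> topspace E" "p d = x" using x(1) by (rule obtain_preimage)
  have "x \<in> to_X V" using x unfolding transfer_def by blast
  moreover have "x \<in> G" using x(2)[OF d] d(2) by blast
  ultimately show "\<exists>y. y \<in> to_X V \<and> y \<in> G" by blast
qed

lemma to_X_Union_subset:
  assumes "\<And>V. V \<in> \<K> \<Longrightarrow> openin Y V"
  shows "to_X (\<Union>\<K>) \<subseteq> X closure_of (\<Union>V\<in>\<K>. to_X V)"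
proof
  fix x assume x: "x \<in> to_X (\<Union>\<K>)"
  then have "x \<in> topspace X" by (simp add: transfer_def)
  then obtain e where e: "e \<in> topspace E" "p e = x" by (rule obtain_preimage)
  then obtain V where V: "V \<in> \<K>" "q e \<in> V" using x by (auto simp: transfer_def)
  have "x \<in> X closure_of (to_X V)"
    using image_in_closure_to_X[OF assms[OF V(1)] e(1) V(2)] e(2) by simp
  moreover have "X closure_of (to_X V) \<subseteq> X closure_of (\<Union>V\<in>\<K>. to_X V)"
    using V(1) by (intro closure_of_mono) blast
  ultimately show "x \<in> X closure_of (\<Union>V\<in>\<K>. to_X V)" by blast
qed

text \<open>
  Apply the condition in \<open>X\<close> to the sets \<open>to_X U\<close>. Two open sets of \<open>Y\<close> meet if their transfers
  do, since \<open>to_X\<close> preserves intersections and sends the empty set to the empty set.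
\<close>

lemma ccc_transfer:
  assumes X: "ccc X"
  shows "ccc Y"
  unfolding ccc_def
proof (intro allI impI)
  fix \<U> assume U: "\<forall>U\<in>\<U>. openin Y U"
  have "\<forall>A\<in>to_X ` \<U>. openin X A" using U openin_to_X by blast
  then obtain \<A> where A: "\<A> \<subseteq> to_X ` \<U>" "countable \<A>" "\<Union>(to_X ` \<U>) \<subseteq> X closure_of \<Union>\<A>"
    using X unfolding ccc_def by meson
  then obtain \<V> where V: "\<V> \<subseteq> \<U>" "countable \<V>" "\<A> = to_X ` \<V>"
    by (meson countable_subset_image)
  have "\<Union>\<U> \<subseteq> Y closure_of \<Union>\<V>"
  proof
    fix y assume "y \<in> \<Union>\<U>"
    then obtain U where Uy: "U \<in> \<U>" "y \<in> U" by blast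
    then have opU: "openin Y U" using U by blast
    show "y \<in> Y closure_of \<Union>\<V>"
      unfolding in_closure_of
    proof (intro conjI allI impI)
      show "y \<in> topspace Y" using opU Uy(2) openin_subset by blast
      fix G assume G: "y \<in> G \<and> openin Y G"
      then have GU: "openin Y (G \<inter> U)" "G \<inter> U \<noteq> {}" using opU Uy(2) by auto
      have "to_X (G \<inter> U) \<noteq> {}" using GU by (rule to_X_nonempty)
      then obtain x where x: "x \<in> to_X (G \<inter> U)" by blast
      then have "x \<in> to_X U" using to_X_mono[of "G \<inter> U" U] by blast
      then have "x \<in> X closure_of \<Union>\<A>" using A(3) Uy(1) by blast
      then obtain x' where x': "x' \<in> \<Union>\<A>" "x' \<in> to_X (G \<inter> U)"
        using openin_to_X[OF GU(1)] x by (rule closure_of_meets)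
      then obtain V where "V \<in> \<V>" "x' \<in> to_X V" using V(3) by blast
      moreover from this have "x' \<in> to_X (G \<inter> U \<inter> V)" using x'(2) by (simp add: to_X_Int)
      then have "G \<inter> U \<inter> V \<noteq> {}" using to_X_empty by auto
      ultimately show "\<exists>y. y \<in> \<Union>\<V> \<and> y \<in> G" by blast
    qed
  qed
  then show "\<exists>\<V>\<subseteq>\<U>. countable \<V> \<and> \<Union>\<U> \<subseteq> Y closure_of \<Union>\<V>"
    using V(1,2) by blast
qed

section \<open>Linked pairs of topologies\<close>

text \<open>
  Together the two conditions say that \<open>\<sigma>\<close> and \<open>\<tau>\<close> determine the same part of the common algebra
  of regular open sets of \<open>X\<close> and \<open>Y\<close>. The first bounds \<open>\<sigma>\<close> in terms of \<open>\<tau>\<close>, the second \<open>\<tau>\<close> in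
  terms of \<open>\<sigma>\<close>; hence the first survives refinements of \<open>\<tau>\<close> and the second refinements of \<open>\<sigma>\<close>.
\<close>

definition closures_saturated :: "'b topology \<Rightarrow> 'a topology \<Rightarrow> bool" where
  "closures_saturated \<sigma> \<tau> \<longleftrightarrow>
     (\<forall>V. openin \<sigma> V \<longrightarrow> saturated \<tau> (X closure_of (to_X V)))"

definition densely_approximated :: "'b topology \<Rightarrow> 'a topology \<Rightarrow> bool" where
  "densely_approximated \<sigma> \<tau> \<longleftrightarrow>
     (\<forall>B. openin \<tau> B \<longrightarrow> to_Y B \<subseteq> Y closure_of \<Union>{W. openin \<sigma> W \<and> W \<subseteq> to_Y B})"

lemma closures_saturated_finer:
  "closures_saturated \<sigma> \<tau> \<Longrightarrow> finer \<tau>' \<tau> \<Longrightarrow> closures_saturated \<sigma> \<tau>'"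
  unfolding closures_saturated_def using saturated_finer by blast

lemma densely_approximated_finer:
  assumes "densely_approximated \<sigma> \<tau>" "finer \<sigma>' \<sigma>"
  shows "densely_approximated \<sigma>' \<tau>"
  unfolding densely_approximated_def
proof (intro allI impI)
  fix B assume "openin \<tau> B"
  then have "to_Y B \<subseteq> Y closure_of \<Union>{W. openin \<sigma> W \<and> W \<subseteq> to_Y B}"
    using assms(1) unfolding densely_approximated_def by blast
  also have "\<dots> \<subseteq> Y closure_of \<Union>{W. openin \<sigma>' W \<and> W \<subseteq> to_Y B}"
    using finerD[OF assms(2)] by (intro closure_of_mono) blast
  finally show "to_Y B \<subseteq> Y closure_of \<Union>{W. openin \<sigma>' W \<and> W \<subseteq> to_Y B}" .
qed

text \<open>
  The closure of \<open>to_X (\<Union>\<K>)\<close> is the closure of a union of saturated sets.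
\<close>

lemma saturated_closure_to_X_Union:
  assumes \<tau>: "open_coarsening X \<tau>"
    and K: "\<And>V. V \<in> \<K> \<Longrightarrow> openin Y V" "\<And>V. V \<in> \<K> \<Longrightarrow> saturated \<tau> (X closure_of (to_X V))"
  shows "saturated \<tau> (X closure_of (to_X (\<Union>\<K>)))"
proof -
  let ?A = "\<Union>V\<in>\<K>. X closure_of (to_X V)"
  have "to_X (\<Union>\<K>) \<subseteq> X closure_of (\<Union>V\<in>\<K>. to_X V)"
    using K(1) by (rule to_X_Union_subset)
  also have "\<dots> \<subseteq> X closure_of ?A"
    using closure_of_subset[OF to_X_subset] by (intro closure_of_mono) blast
  finally have "X closure_of (to_X (\<Union>\<K>)) \<subseteq> X closure_of ?A"
    by (rule closure_of_minimal) simp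
  moreover have "X closure_of (to_X V) \<subseteq> X closure_of (to_X (\<Union>\<K>))" if "V \<in> \<K>" for V
    using that by (intro closure_of_mono to_X_mono) blast
  then have "?A \<subseteq> X closure_of (to_X (\<Union>\<K>))" by (rule UN_least)
  then have "X closure_of ?A \<subseteq> X closure_of (to_X (\<Union>\<K>))"
    by (rule closure_of_minimal) simp
  ultimately have "X closure_of (to_X (\<Union>\<K>)) = X closure_of ?A" by (rule subset_antisym)
  moreover have "saturated \<tau> ?A" using K(2) by (intro saturated_Union) blast
  then have "saturated \<tau> (X closure_of ?A)" using \<tau> by (rule saturated_closure[rotated])
  ultimately show ?thesis by simp
qed

text \<open>
  The closure of the intersection of two open sets is the closure of the intersection of the
  interiors of their closures, and all of these operations preserve saturated sets.
\<close>

lemma saturated_closure_to_X_Int: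
  assumes \<tau>: "open_coarsening X \<tau>"
    and V: "openin Y V" "saturated \<tau> (X closure_of (to_X V))"
    and W: "openin Y W" "saturated \<tau> (X closure_of (to_X W))"
  shows "saturated \<tau> (X closure_of (to_X (V \<inter> W)))"
proof -
  let ?A = "X closure_of (to_X V)" and ?B = "X closure_of (to_X W)"
  let ?I = "X interior_of ?A \<inter> X interior_of ?B"
  have oV: "openin X (to_X V)" and oW: "openin X (to_X W)" using V(1) W(1) by (auto intro: openin_to_X)
  have "to_X V \<subseteq> X interior_of ?A" "to_X W \<subseteq> X interior_of ?B"
    by (intro interior_of_maximal closure_of_subset to_X_subset oV oW)+
  then have "to_X (V \<inter> W) \<subseteq> ?I" unfolding to_X_Int by blast
  then have 1: "X closure_of (to_X (V \<inter> W)) \<subseteq> X closure_of ?I" by (rule closure_of_mono)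
  have "?I \<subseteq> X closure_of (to_X (V \<inter> W))"
  proof
    fix x assume x: "x \<in> ?I"
    show "x \<in> X closure_of (to_X (V \<inter> W))"
      unfolding in_closure_of
    proof (intro conjI allI impI)
      show "x \<in> topspace X" using x interior_of_subset_topspace[of X ?A] by blast
      fix G assume G: "x \<in> G \<and> openin X G"
      have oI: "openin X ?I" by auto
      have "x \<in> ?A" using x interior_of_subset[of X ?A] by blast
      moreover have "openin X (G \<inter> ?I)" using G oI by blast
      moreover have "x \<in> G \<inter> ?I" using x G by blast
      ultimately obtain y where y: "y \<in> to_X V" "y \<in> G \<inter> ?I" by (rule closure_of_meets)
      have "y \<in> ?B" using y(2) interior_of_subset[of X ?B] by blast
      moreover have "openin X (G \<inter> to_X V)" using G oV by blast
      moreover have "y \<in> G \<inter> to_X V" using y by blast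
      ultimately obtain z where "z \<in> to_X W" "z \<in> G \<inter> to_X V" by (rule closure_of_meets)
      then show "\<exists>y. y \<in> to_X (V \<inter> W) \<and> y \<in> G" unfolding to_X_Int by blast
    qed
  qed
  then have "X closure_of ?I \<subseteq> X closure_of (to_X (V \<inter> W))"
    by (rule closure_of_minimal) simp
  with 1 have "X closure_of (to_X (V \<inter> W)) = X closure_of ?I" by (rule subset_antisym)
  moreover have "saturated \<tau> ?I"
    using \<tau> V(2) W(2) by (intro saturated_Int saturated_interior)
  then have "saturated \<tau> (X closure_of ?I)" using \<tau> by (rule saturated_closure[rotated])
  ultimately show ?thesis by simp
qed

lemma closures_saturated_join:
  assumes \<tau>: "open_coarsening X \<tau>"
    and S: "\<And>\<sigma>. \<sigma> \<in> \<S> \<Longrightarrow> coarsening Y \<sigma>" "\<And>\<sigma>. \<sigma> \<in> \<S> \<Longrightarrow> closures_saturated \<sigma> \<tau>"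
  shows "closures_saturated (join (topspace Y) \<S>) \<tau>"
  unfolding closures_saturated_def
proof (intro allI impI)
  have op: "openin Y V" if "openin (join (topspace Y) \<S>) V" for V
    using coarsening_join[of \<S> Y] S(1) that coarseningD(2) by blast
  fix V assume "openin (join (topspace Y) \<S>) V"
  then show "saturated \<tau> (X closure_of (to_X V))"
  proof (induction rule: join_induct)
    case carrier
    have "saturated \<tau> (topspace X)"
      using open_coarseningD(2)[OF \<tau>] by (simp add: saturated_def)
    then show ?case by (simp add: to_X_topspace)
  next
    case (member \<sigma> V)
    then show ?case using S(2) unfolding closures_saturated_def by blast
  next
    case (Int U V)
    then show ?case by (intro saturated_closure_to_X_Int \<tau> op)
  next
    case (Union \<K>)
    then show ?case by (intro saturated_closure_to_X_Union \<tau> op)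
  qed
qed

lemma densely_approximated_Union:
  assumes \<sigma>: "coarsening Y \<sigma>" and K: "\<And>B. B \<in> \<K> \<Longrightarrow> openin X B"
    "\<And>B. B \<in> \<K> \<Longrightarrow> to_Y B \<subseteq> Y closure_of \<Union>{W. openin \<sigma> W \<and> W \<subseteq> to_Y B}"
  shows "to_Y (\<Union>\<K>) \<subseteq> Y closure_of \<Union>{W. openin \<sigma> W \<and> W \<subseteq> to_Y (\<Union>\<K>)}"
proof -
  interpret swap: roof E Y X q p by (rule swap)
  let ?D = "\<Union>{W. openin \<sigma> W \<and> W \<subseteq> to_Y (\<Union>\<K>)}"
  have "to_Y B \<subseteq> Y closure_of ?D" if B: "B \<in> \<K>" for B
  proof -
    have "to_Y B \<subseteq> to_Y (\<Union>\<K>)" using B by (intro swap.to_X_mono) blast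
    then have "Y closure_of \<Union>{W. openin \<sigma> W \<and> W \<subseteq> to_Y B} \<subseteq> Y closure_of ?D"
      by (intro closure_of_mono) blast
    with K(2)[OF B] show ?thesis by (rule subset_trans)
  qed
  then have "(\<Union>B\<in>\<K>. to_Y B) \<subseteq> Y closure_of ?D" by blast
  then have "Y closure_of (\<Union>B\<in>\<K>. to_Y B) \<subseteq> Y closure_of ?D"
    by (rule closure_of_minimal) simp
  with swap.to_X_Union_subset[OF K(1)] show ?thesis by (rule subset_trans)
qed

lemma densely_approximated_join:
  assumes \<sigma>: "coarsening Y \<sigma>"
    and T: "\<And>\<tau>. \<tau> \<in> \<T> \<Longrightarrow> coarsening X \<tau>" "\<And>\<tau>. \<tau> \<in> \<T> \<Longrightarrow> densely_approximated \<sigma> \<tau>"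
  shows "densely_approximated \<sigma> (join (topspace X) \<T>)"
  unfolding densely_approximated_def
proof (intro allI impI)
  interpret swap: roof E Y X q p by (rule swap)
  have op: "openin X B" if "openin (join (topspace X) \<T>) B" for B
    using coarsening_join[of \<T> X] T(1) that coarseningD(2) by blast
  fix B assume "openin (join (topspace X) \<T>) B"
  then show "to_Y B \<subseteq> Y closure_of \<Union>{W. openin \<sigma> W \<and> W \<subseteq> to_Y B}"
  proof (induction rule: join_induct)
    case carrier
    have "openin \<sigma> (topspace Y)" using coarseningD(1)[OF \<sigma>] by (metis openin_topspace)
    then have "topspace Y \<subseteq> \<Union>{W. openin \<sigma> W \<and> W \<subseteq> topspace Y}" by blast
    moreover have "\<Union>{W. openin \<sigma> W \<and> W \<subseteq> topspace Y} \<subseteq> topspace Y" by blast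
    ultimately have "\<Union>{W. openin \<sigma> W \<and> W \<subseteq> topspace Y} = topspace Y" by blast
    then show ?case by (simp add: swap.to_X_topspace)
  next
    case (member \<tau> B)
    then show ?case using T(2) unfolding densely_approximated_def by blast
  next
    case (Int A B)
    let ?D = "\<lambda>A. \<Union>{W. openin \<sigma> W \<and> W \<subseteq> to_Y A}"
    have oD: "openin Y (?D C)" for C using coarseningD(2)[OF \<sigma>] by blast
    have oA: "openin Y (to_Y A)" and oB: "openin Y (to_Y B)"
      using Int(1,2) op swap.openin_to_X by blast+
    show ?case
    proof
      fix y assume "y \<in> to_Y (A \<inter> B)"
      then have y: "y \<in> to_Y A" "y \<in> to_Y B" by (auto simp: swap.to_X_Int)
      show "y \<in> Y closure_of (?D (A \<inter> B))"
        unfolding in_closure_of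
      proof (intro conjI allI impI)
        show "y \<in> topspace Y" using y(1) by (simp add: transfer_def)
        fix G assume G: "y \<in> G \<and> openin Y G"
        have "y \<in> Y closure_of (?D A)" using Int(3) y(1) by blast
        moreover have "openin Y (G \<inter> to_Y B)" using G oB by blast
        moreover have "y \<in> G \<inter> to_Y B" using G y(2) by blast
        ultimately obtain z where z: "z \<in> ?D A" "z \<in> G \<inter> to_Y B" by (rule closure_of_meets)
        have "z \<in> Y closure_of (?D B)" using Int(4) z(2) by blast
        moreover have "openin Y (G \<inter> ?D A)" using G oD by blast
        moreover have "z \<in> G \<inter> ?D A" using z by blast
        ultimately obtain w where w: "w \<in> ?D B" "w \<in> G \<inter> ?D A" by (rule closure_of_meets)
        from w(2) have "w \<in> ?D A" by (rule IntD2)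
        then obtain W1 where W1: "openin \<sigma> W1" "W1 \<subseteq> to_Y A" "w \<in> W1" by blast
        obtain W2 where W2: "openin \<sigma> W2" "W2 \<subseteq> to_Y B" "w \<in> W2" using w(1) by blast
        have "openin \<sigma> (W1 \<inter> W2)" using W1(1) W2(1) by blast
        moreover have "W1 \<inter> W2 \<subseteq> to_Y (A \<inter> B)" using W1(2) W2(2) by (auto simp: swap.to_X_Int)
        ultimately have "w \<in> ?D (A \<inter> B)" using W1(3) W2(3) by blast
        then show "\<exists>z. z \<in> ?D (A \<inter> B) \<and> z \<in> G" using IntD1[OF w(2)] by (intro exI conjI)
      qed
    qed
  next
    case (Union \<K>)
    then show ?case by (intro densely_approximated_Union \<sigma> op)
  qed
qed


text \<open>
  One topology of countable weight for each member of a base of \<open>\<sigma>\<close>.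
\<close>

lemma obtain_saturating_coarsening:
  assumes X: "completely_regular_space X" and L: "topology_lattice X \<L>"
    and op: "\<forall>\<tau>\<in>\<L>. open_coarsening X \<tau>" and \<sigma>: "coarsening Y \<sigma>"
  shows "\<exists>\<tau>\<in>\<L>. weight \<tau> \<le>o weight \<sigma> \<and> closures_saturated \<sigma> \<tau>"
proof -
  obtain b where b: "base_of \<sigma> b" "|b| \<le>o weight \<sigma>" by (rule obtain_weight_base)
  have ob: "openin Y V" if "V \<in> b" for V
    using that b(1) coarseningD(2)[OF \<sigma>] by (simp add: base_of_iff)
  have "\<forall>V\<in>b. \<exists>\<tau>. \<tau> \<in> \<L> \<and> weight \<tau> \<le>o natLeq \<and> saturated \<tau> (X closure_of (to_X V))"
    using countable_weight_saturating[OF X L op openin_to_X[OF ob]] by blast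
  then obtain s where s': "\<forall>V\<in>b. s V \<in> \<L> \<and> weight (s V) \<le>o natLeq \<and>
      saturated (s V) (X closure_of (to_X V))"
    by (rule bchoice[THEN exE])
  have s: "s V \<in> \<L>" "weight (s V) \<le>o natLeq" "saturated (s V) (X closure_of (to_X V))"
    if "V \<in> b" for V
    using bspec[OF s' that] by simp_all
  let ?\<tau> = "join (topspace X) (s ` b)"
  have "s ` b \<subseteq> \<L>" using s(1) by auto
  then have \<tau>: "?\<tau> \<in> \<L>" by (rule topology_latticeD(3)[OF L])
  then have op\<tau>: "open_coarsening X ?\<tau>" using op by blast
  have top: "topspace \<rho> = topspace X" if "\<rho> \<in> s ` b" for \<rho>
    using that s(1) coarseningD(1)[OF topology_latticeD(1)[OF L]] by blast
  have "weight ?\<tau> \<le>o weight \<sigma>"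
  proof (rule weight_join_le[OF top])
    show "|s ` b| \<le>o weight \<sigma>" using card_of_image b(2) by (rule ordLeq_transitive)
    fix \<rho> assume "\<rho> \<in> s ` b"
    then have "weight \<rho> \<le>o natLeq" using s(2) by auto
    then show "weight \<rho> \<le>o weight \<sigma>" using natLeq_le_weight by (rule ordLeq_transitive)
  qed (assumption, rule Cinfinite_weight)
  moreover have "closures_saturated \<sigma> ?\<tau>"
    unfolding closures_saturated_def
  proof (intro allI impI)
    fix V assume V: "openin \<sigma> V"
    let ?K = "{B \<in> b. B \<subseteq> V}"
    have "V \<subseteq> \<Union>?K"
    proof
      fix x assume "x \<in> V"
      then obtain B where "B \<in> b" "x \<in> B" "B \<subseteq> V" using b(1) V unfolding base_of_iff by meson
      then show "x \<in> \<Union>?K" by blast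
    qed
    then have VK: "V = \<Union>?K" by blast
    have "saturated ?\<tau> (X closure_of (to_X B))" if B: "B \<in> ?K" for B
    proof -
      have "finer ?\<tau> (s B)" using B by (intro finer_join top) auto
      then show ?thesis using s(3) B by (intro saturated_finer[of ?\<tau> "s B"]) auto
    qed
    then have "saturated ?\<tau> (X closure_of (to_X (\<Union>?K)))"
      using ob by (intro saturated_closure_to_X_Union op\<tau>) auto
    then show "saturated ?\<tau> (X closure_of (to_X V))" using VK by simp
  qed
  ultimately show ?thesis using \<tau> by (intro bexI[of _ ?\<tau>] conjI)
qed

text \<open>
  One topology of countable weight for each member of a base of \<open>\<tau>\<close>.
\<close>

lemma obtain_approximating_coarsening:
  assumes Y: "completely_regular_space Y" "ccc Y" and \<tau>: "coarsening X \<tau>"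
  shows "\<exists>\<sigma>. coarsening Y \<sigma> \<and> weight \<sigma> \<le>o weight \<tau> \<and> densely_approximated \<sigma> \<tau>"
proof -
  interpret swap: roof E Y X q p by (rule swap)
  obtain b where b: "base_of \<tau> b" "|b| \<le>o weight \<tau>" by (rule obtain_weight_base)
  have ob: "openin X B" if "B \<in> b" for B
    using that b(1) coarseningD(2)[OF \<tau>] by (simp add: base_of_iff)
  have "\<forall>B\<in>b. \<exists>\<sigma>. coarsening Y \<sigma> \<and> weight \<sigma> \<le>o natLeq \<and>
      (\<exists>W. openin \<sigma> W \<and> W \<subseteq> to_Y B \<and> to_Y B \<subseteq> Y closure_of W)"
  proof
    fix B assume "B \<in> b"
    from countable_weight_dense_open[OF Y swap.openin_to_X[OF ob[OF this]]]
    obtain \<sigma> W where "coarsening Y \<sigma>" "weight \<sigma> \<le>o natLeq"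
      "openin \<sigma> W" "W \<subseteq> to_Y B" "to_Y B \<subseteq> Y closure_of W"
      by (elim exE conjE)
    then show "\<exists>\<sigma>. coarsening Y \<sigma> \<and> weight \<sigma> \<le>o natLeq \<and>
      (\<exists>W. openin \<sigma> W \<and> W \<subseteq> to_Y B \<and> to_Y B \<subseteq> Y closure_of W)"
      by (intro exI conjI)
  qed
  then obtain s where s': "\<forall>B\<in>b. coarsening Y (s B) \<and> weight (s B) \<le>o natLeq \<and>
      (\<exists>W. openin (s B) W \<and> W \<subseteq> to_Y B \<and> to_Y B \<subseteq> Y closure_of W)"
    by (rule bchoice[THEN exE])
  have s: "coarsening Y (s B)" "weight (s B) \<le>o natLeq"
    "\<exists>W. openin (s B) W \<and> W \<subseteq> to_Y B \<and> to_Y B \<subseteq> Y closure_of W"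
    if "B \<in> b" for B
    using bspec[OF s' that] by simp_all
  let ?\<sigma> = "join (topspace Y) (s ` b)"
  have \<sigma>: "coarsening Y ?\<sigma>" using s(1) by (intro coarsening_join) auto
  moreover have "weight ?\<sigma> \<le>o weight \<tau>"
  proof (rule weight_join_le)
    show "topspace \<rho> = topspace Y" if "\<rho> \<in> s ` b" for \<rho>
      using that s(1) coarseningD(1) by blast
    show "|s ` b| \<le>o weight \<tau>" using card_of_image b(2) by (rule ordLeq_transitive)
    fix \<rho> assume "\<rho> \<in> s ` b"
    then have "weight \<rho> \<le>o natLeq" using s(2) by auto
    then show "weight \<rho> \<le>o weight \<tau>" using natLeq_le_weight by (rule ordLeq_transitive)
  qed (rule Cinfinite_weight)
  moreover have "densely_approximated ?\<sigma> \<tau>"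
    unfolding densely_approximated_def
  proof (intro allI impI)
    fix V assume V: "openin \<tau> V"
    let ?K = "{B \<in> b. B \<subseteq> V}"
    have "V \<subseteq> \<Union>?K"
    proof
      fix x assume "x \<in> V"
      then obtain B where "B \<in> b" "x \<in> B" "B \<subseteq> V" using b(1) V unfolding base_of_iff by meson
      then show "x \<in> \<Union>?K" by blast
    qed
    then have VK: "V = \<Union>?K" by blast
    have "to_Y B \<subseteq> Y closure_of \<Union>{W. openin ?\<sigma> W \<and> W \<subseteq> to_Y B}" if B: "B \<in> ?K" for B
    proof -
      from B have Bb: "B \<in> b" by blast
      obtain W where W: "openin (s B) W" "W \<subseteq> to_Y B" "to_Y B \<subseteq> Y closure_of W"
        using s(3)[OF Bb] by blast
      have "openin ?\<sigma> W" using Bb W(1) by (intro openin_join_member[of "s B"]) auto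
      then have "W \<subseteq> \<Union>{W. openin ?\<sigma> W \<and> W \<subseteq> to_Y B}" using W(2) by blast
      then have "Y closure_of W \<subseteq> Y closure_of \<Union>{W. openin ?\<sigma> W \<and> W \<subseteq> to_Y B}"
        by (rule closure_of_mono)
      with W(3) show ?thesis by (rule subset_trans)
    qed
    then have "to_Y (\<Union>?K) \<subseteq> Y closure_of \<Union>{W. openin ?\<sigma> W \<and> W \<subseteq> to_Y (\<Union>?K)}"
      using ob by (intro densely_approximated_Union \<sigma>) auto
    then show "to_Y V \<subseteq> Y closure_of \<Union>{W. openin ?\<sigma> W \<and> W \<subseteq> to_Y V}"
      using VK by simp
  qed
  ultimately show ?thesis by blast
qed

section \<open>Linked topologies are semi-open\<close>

text \<open>
  If no point of the compact set \<open>q(p\<inverse>(x))\<close> were indistinguishable from \<open>q e\<close>, disjoint \<open>\<sigma>\<close>-open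
  sets \<open>U\<close> and \<open>V\<close> would separate them. Then \<open>p e\<close> lies in the closure of \<open>to_X U\<close>, which is
  saturated and therefore contains \<open>x\<close>, while \<open>to_X V\<close> is a neighbourhood of \<open>x\<close> disjoint from
  \<open>to_X U\<close>.
\<close>

lemma indist_fibres:
  assumes comp: "\<And>x. x \<in> topspace X \<Longrightarrow> compactin E {e \<in> topspace E. p e = x}"
    and \<sigma>: "coarsening Y \<sigma>" and \<tau>: "coarsening X \<tau>" and sat: "closures_saturated \<sigma> \<tau>"
    and e: "e \<in> topspace E" and x: "x \<in> topspace X" "indist \<tau> (p e) x"
  shows "\<exists>d\<in>topspace E. p d = x \<and> indist \<sigma> (q d) (q e)"
proof (rule ccontr)
  assume contra: "\<not> ?thesis"
  let ?F = "q ` {d \<in> topspace E. p d = x}"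
  have qtop: "q d \<in> topspace \<sigma>" if "d \<in> topspace E" for d
    using closed_irreducibleD(4)[OF q that] coarseningD(1)[OF \<sigma>] by simp
  have "openin E {d \<in> topspace E. q d \<in> U}" if "openin \<sigma> U" for U
    using coarseningD(2)[OF \<sigma> that] by (rule openin_preimage)
  then have "continuous_map E \<sigma> q"
    using qtop by (auto simp: continuous_map_def)
  then have F: "compactin \<sigma> ?F" using comp[OF x(1)] by (rule image_compactin[rotated])
  \<comment> \<open>Asking for \<open>q e\<close> outside the closure makes the condition survive finite unions.\<close>
  let ?\<U> = "{V. openin \<sigma> V \<and> q e \<notin> \<sigma> closure_of V}"
  have "?F \<subseteq> \<Union>?\<U>"
  proof
    fix z assume "z \<in> ?F"
    then obtain d where d: "d \<in> topspace E" "p d = x" "z = q d" by blast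
    then have "\<not> indist \<sigma> z (q e)" using contra by blast
    moreover have "regular_space \<sigma>"
      using coarseningD(3)[OF \<sigma>] by (rule completely_regular_imp_regular_space)
    ultimately have "\<exists>V. openin \<sigma> V \<and> z \<in> V \<and> q e \<notin> \<sigma> closure_of V"
      using qtop d(1,3) e by (intro regular_separation) auto
    then show "z \<in> \<Union>?\<U>" by blast
  qed
  then obtain \<F> where \<F>: "finite \<F>" "\<F> \<subseteq> ?\<U>" "?F \<subseteq> \<Union>\<F>"
    using F unfolding compactin_def by (metis (no_types, lifting) mem_Collect_eq)
  let ?V = "\<Union>\<F>"
  let ?U = "topspace \<sigma> - \<sigma> closure_of ?V"
  have "openin \<sigma> ?V" using \<F>(2) by blast
  then have V: "openin Y ?V" by (rule coarseningD(2)[OF \<sigma>])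
  have oU: "openin \<sigma> ?U" by (simp add: openin_diff)
  then have U: "openin Y ?U" by (rule coarseningD(2)[OF \<sigma>])
  have "q e \<notin> \<sigma> closure_of ?V" using \<F>(1,2) by (auto simp: closure_of_Union)
  then have "q e \<in> ?U" using qtop[OF e] by blast
  then have "p e \<in> X closure_of (to_X ?U)" using U e by (intro image_in_closure_to_X)
  moreover have "saturated \<tau> (X closure_of (to_X ?U))"
    using sat oU unfolding closures_saturated_def by blast
  ultimately have "x \<in> X closure_of (to_X ?U)"
    using x coarseningD(1)[OF \<tau>] unfolding saturated_def by blast
  moreover have "openin X (to_X ?V)" using V by (rule openin_to_X)
  moreover have "x \<in> to_X ?V" using x(1) \<F>(3) unfolding transfer_def by blast
  ultimately obtain z where "z \<in> to_X ?U" "z \<in> to_X ?V" by (rule closure_of_meets)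
  then have "z \<in> to_X (?U \<inter> ?V)" by (simp add: to_X_Int)
  moreover have "?V \<subseteq> \<sigma> closure_of ?V"
    using \<open>openin \<sigma> ?V\<close> by (intro closure_of_subset openin_subset)
  then have "?U \<inter> ?V = {}" by blast
  ultimately show False by (simp add: to_X_empty)
qed

text \<open>
  For \<open>z\<close> in \<open>W\<close> pick \<open>e\<close> over \<open>z\<close>. Then \<open>p e\<close> is indistinguishable from some \<open>x\<close> in \<open>to_X U\<close>,
  so the fibre over \<open>x\<close> contains a \<open>d\<close> with \<open>q d\<close> indistinguishable from \<open>z\<close>, and \<open>q d\<close> lies in
  \<open>U\<close>.
\<close>

lemma semi_open_coarsening:
  assumes comp: "\<And>x. x \<in> topspace X \<Longrightarrow> compactin E {e \<in> topspace E. p e = x}"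
    and \<sigma>: "coarsening Y \<sigma>" and \<tau>: "open_coarsening X \<tau>"
    and sat: "closures_saturated \<sigma> \<tau>" and dense: "densely_approximated \<sigma> \<tau>"
    and U: "openin Y U" "U \<noteq> {}"
  shows "\<exists>W. openin \<sigma> W \<and> W \<noteq> {} \<and> W \<subseteq> saturation \<sigma> U"
proof -
  interpret swap: roof E Y X q p by (rule swap)
  note co = open_coarseningD(1)[OF \<tau>]
  let ?B = "saturation \<tau> (to_X U)"
  have B: "openin \<tau> ?B" "openin X ?B"
    using openin_to_X[OF U(1)] by (rule open_coarseningD[OF \<tau>])+
  have "to_X U \<subseteq> ?B"
    using to_X_subset coarseningD(1)[OF co] by (intro subset_saturation) simp
  then have "?B \<noteq> {}" using to_X_nonempty[OF U] by blast
  then obtain y where y: "y \<in> to_Y ?B" using swap.to_X_nonempty[OF B(2)] by blast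
  then have "y \<in> Y closure_of \<Union>{W. openin \<sigma> W \<and> W \<subseteq> to_Y ?B}"
    using dense B(1) unfolding densely_approximated_def by blast
  moreover have "openin Y (topspace Y)" "y \<in> topspace Y"
    using y by (auto simp: transfer_def)
  ultimately obtain w where w: "w \<in> \<Union>{W. openin \<sigma> W \<and> W \<subseteq> to_Y ?B}" by (rule closure_of_meets)
  then obtain W where W: "openin \<sigma> W" "w \<in> W" "W \<subseteq> to_Y ?B" by blast
  have "W \<subseteq> saturation \<sigma> U"
  proof
    fix z assume z: "z \<in> W"
    then have "z \<in> to_Y ?B" using W(3) by blast
    then have zt: "z \<in> topspace Y" by (simp add: transfer_def)
    then obtain e where e: "e \<in> topspace E" "q e = z" by (rule swap.obtain_preimage)
    then have "p e \<in> ?B" using \<open>z \<in> to_Y ?B\<close> by (simp add: transfer_def)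
    then obtain x where x: "x \<in> to_X U" "indist \<tau> x (p e)" by (auto simp: saturation_def)
    then have "x \<in> topspace X" using to_X_subset by blast
    then obtain d where d: "d \<in> topspace E" "p d = x" "indist \<sigma> (q d) (q e)"
      using indist_fibres[OF comp \<sigma> co sat e(1) _ x(2)[symmetric]] by blast
    then have "q d \<in> U" using x(1) by (simp add: transfer_def)
    then show "z \<in> saturation \<sigma> U"
      using d(3) e(2) zt coarseningD(1)[OF \<sigma>] by (auto simp: saturation_def)
  qed
  then show ?thesis using W by blast
qed

section \<open>The transferred lattice\<close>

definition lattice_transfer :: "'a topology set \<Rightarrow> 'b topology set" where
  "lattice_transfer \<L> = {\<sigma>. coarsening Y \<sigma> \<and>
     (\<exists>\<tau>\<in>\<L>. closures_saturated \<sigma> \<tau> \<and> densely_approximated \<sigma> \<tau>)}"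

text \<open>
  Each of the two conditions may hold with a different partner in the other family. This covers
  both a subfamily of the new lattice and the two interleaved sequences of the refinement
  argument.
\<close>

lemma lattice_transfer_join:
  assumes L: "topology_lattice X \<L>" and op: "\<forall>\<tau>\<in>\<L>. open_coarsening X \<tau>"
    and S: "\<And>\<sigma>. \<sigma> \<in> \<S> \<Longrightarrow> coarsening Y \<sigma>" and T: "\<T> \<subseteq> \<L>"
    and sat: "\<And>\<sigma>. \<sigma> \<in> \<S> \<Longrightarrow> \<exists>\<tau>\<in>\<T>. closures_saturated \<sigma> \<tau>"
    and dense: "\<And>\<tau>. \<tau> \<in> \<T> \<Longrightarrow> \<exists>\<sigma>\<in>\<S>. densely_approximated \<sigma> \<tau>"
  shows "join (topspace Y) \<S> \<in> lattice_transfer \<L>"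
proof -
  let ?\<sigma> = "join (topspace Y) \<S>" and ?\<tau> = "join (topspace X) \<T>"
  have \<tau>: "?\<tau> \<in> \<L>" using L T by (rule topology_latticeD)
  have co: "coarsening X \<tau>" if "\<tau> \<in> \<T>" for \<tau>
    using that T by (intro topology_latticeD(1)[OF L]) blast
  have \<sigma>: "coarsening Y ?\<sigma>" using S by (rule coarsening_join)
  have "closures_saturated \<sigma> ?\<tau>" if \<sigma>S: "\<sigma> \<in> \<S>" for \<sigma>
  proof -
    obtain \<tau> where t: "\<tau> \<in> \<T>" "closures_saturated \<sigma> \<tau>" using sat[OF \<sigma>S] by blast
    have "finer ?\<tau> \<tau>" using coarseningD(1)[OF co] t(1) by (rule finer_join)
    with t(2) show ?thesis by (rule closures_saturated_finer)
  qed
  then have 1: "closures_saturated ?\<sigma> ?\<tau>"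
    using bspec[OF op \<tau>] S by (intro closures_saturated_join)
  have "densely_approximated ?\<sigma> \<tau>" if \<tau>T: "\<tau> \<in> \<T>" for \<tau>
  proof -
    obtain \<sigma> where s: "\<sigma> \<in> \<S>" "densely_approximated \<sigma> \<tau>" using dense[OF \<tau>T] by blast
    have "finer ?\<sigma> \<sigma>" using coarseningD(1)[OF S] s(1) by (rule finer_join)
    with s(2) show ?thesis by (rule densely_approximated_finer)
  qed
  then have "densely_approximated ?\<sigma> ?\<tau>"
    using \<sigma> co by (intro densely_approximated_join)
  then show ?thesis using \<sigma> \<tau> 1 unfolding lattice_transfer_def by blast
qed

text \<open>
  Starting from \<open>\<rho>\<close>, choose alternately \<open>\<tau>\<^sub>n\<close> for \<open>\<sigma>\<^sub>n\<close> by \<open>obtain_saturating_coarsening\<close> and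
  \<open>\<sigma>\<^sub>n\<^sub>+\<^sub>1\<close> for \<open>\<tau>\<^sub>n\<close> by \<open>obtain_approximating_coarsening\<close>. No step raises the weight, and the
  joins of the two sequences are linked.
\<close>

lemma lattice_transfer_refines:
  assumes X: "completely_regular_space X" and Y: "completely_regular_space Y"
    and L: "topology_lattice X \<L>" and op: "\<forall>\<tau>\<in>\<L>. open_coarsening X \<tau>"
    and \<rho>: "coarsening Y \<rho>"
  shows "\<exists>\<sigma>\<in>lattice_transfer \<L>. finer \<sigma> \<rho> \<and> weight \<sigma> \<le>o weight \<rho>"
proof -
  have cY: "ccc Y" using open_lattice_imp_ccc[OF X L op] by (rule ccc_transfer)
  \<comment> \<open>The last conjunct starts the sequence at \<open>\<rho>\<close>, so that the join refines it.\<close>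
  define P where "P = (\<lambda>(n::nat) (\<sigma>, \<tau>). coarsening Y \<sigma> \<and> weight \<sigma> \<le>o weight \<rho> \<and> \<tau> \<in> \<L> \<and>
    weight \<tau> \<le>o weight \<rho> \<and> closures_saturated \<sigma> \<tau> \<and> (n = 0 \<longrightarrow> \<sigma> = \<rho>))"
  define Q where "Q = (\<lambda>(n::nat) (\<sigma> :: 'b topology, \<tau>) (\<sigma>', \<tau>' :: 'a topology). densely_approximated \<sigma>' \<tau>)"
  have "\<exists>f. \<forall>n. P n (f n) \<and> Q n (f n) (f (Suc n))"
  proof (rule dependent_nat_choice)
    obtain \<tau> where "\<tau> \<in> \<L>" "weight \<tau> \<le>o weight \<rho>" "closures_saturated \<rho> \<tau>"
      using obtain_saturating_coarsening[OF X L op \<rho>] by blast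
    moreover have "weight \<rho> \<le>o weight \<rho>"
      by (rule ordLeq_refl) (simp add: Cinfinite_weight)
    ultimately have "P 0 (\<rho>, \<tau>)" using \<rho> by (simp add: P_def)
    then show "\<exists>z. P 0 z" by blast
  next
    fix z and n :: nat assume z: "P n z"
    obtain \<sigma> \<tau> where z': "z = (\<sigma>, \<tau>)" by (cases z)
    have \<tau>: "coarsening X \<tau>" "weight \<tau> \<le>o weight \<rho>"
      using z topology_latticeD(1)[OF L] by (auto simp: P_def z')
    obtain \<sigma>' where \<sigma>': "coarsening Y \<sigma>'" "weight \<sigma>' \<le>o weight \<tau>" "densely_approximated \<sigma>' \<tau>"
      using obtain_approximating_coarsening[OF Y cY \<tau>(1)] by blast
    obtain \<tau>' where \<tau>': "\<tau>' \<in> \<L>" "weight \<tau>' \<le>o weight \<sigma>'" "closures_saturated \<sigma>' \<tau>'"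
      using obtain_saturating_coarsening[OF X L op \<sigma>'(1)] by blast
    have w: "weight \<sigma>' \<le>o weight \<rho>" using \<sigma>'(2) \<tau>(2) by (rule ordLeq_transitive)
    have "weight \<tau>' \<le>o weight \<rho>" using \<tau>'(2) w by (rule ordLeq_transitive)
    then have "P (Suc n) (\<sigma>', \<tau>')" using \<sigma>'(1) \<tau>'(1,3) w by (simp add: P_def)
    moreover have "Q n z (\<sigma>', \<tau>')" using \<sigma>'(3) by (simp add: Q_def z')
    ultimately show "\<exists>y. P (Suc n) y \<and> Q n z y" by blast
  qed
  then obtain f where f: "\<And>n. P n (f n)" "\<And>n. Q n (f n) (f (Suc n))" by blast
  define s where "s n = fst (f n)" for n
  define t where "t n = snd (f n)" for n
  have fst: "f n = (s n, t n)" for n by (simp add: s_def t_def)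
  have s: "coarsening Y (s n)" "weight (s n) \<le>o weight \<rho>" "t n \<in> \<L>" "closures_saturated (s n) (t n)"
    and s0: "s 0 = \<rho>" for n
    using f(1)[of n] f(1)[of 0] by (simp_all add: P_def fst)
  have d: "densely_approximated (s (Suc n)) (t n)" for n
    using f(2)[of n] by (simp add: Q_def fst)
  let ?\<sigma> = "join (topspace Y) (range s)"
  have "?\<sigma> \<in> lattice_transfer \<L>"
  proof (rule lattice_transfer_join[OF L op])
    show "range t \<subseteq> \<L>" using s(3) by blast
    show "coarsening Y \<sigma>" if "\<sigma> \<in> range s" for \<sigma> using that s(1) by blast
    show "\<exists>\<tau>\<in>range t. closures_saturated \<sigma> \<tau>" if "\<sigma> \<in> range s" for \<sigma> using that s(4) by blast
    show "\<exists>\<sigma>\<in>range s. densely_approximated \<sigma> \<tau>" if "\<tau> \<in> range t" for \<tau> using that d by blast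
  qed
  moreover have top: "topspace \<sigma> = topspace Y" if "\<sigma> \<in> range s" for \<sigma>
    using that coarseningD(1)[OF s(1)] by blast
  have "finer ?\<sigma> (s 0)" using top rangeI by (rule finer_join)
  then have "finer ?\<sigma> \<rho>" by (simp add: s0)
  moreover have "weight ?\<sigma> \<le>o weight \<rho>"
  proof (rule weight_join_le[OF top])
    show "|range s| \<le>o weight \<rho>" using natLeq_le_weight by (rule card_range_nat)
    show "weight \<sigma> \<le>o weight \<rho>" if "\<sigma> \<in> range s" for \<sigma> using that s(2) by blast
  qed (assumption, rule Cinfinite_weight)
  ultimately show ?thesis by blast
qed

lemma topology_lattice_transfer:
  assumes X: "completely_regular_space X" and Y: "completely_regular_space Y"
    and L: "topology_lattice X \<L>" and op: "\<forall>\<tau>\<in>\<L>. open_coarsening X \<tau>"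
  shows "topology_lattice Y (lattice_transfer \<L>)"
  unfolding topology_lattice_def
proof (intro conjI ballI allI impI)
  show "coarsening Y \<sigma>" if "\<sigma> \<in> lattice_transfer \<L>" for \<sigma>
    using that by (simp add: lattice_transfer_def)
  show "\<exists>\<sigma>\<in>lattice_transfer \<L>. finer \<sigma> \<rho> \<and> weight \<sigma> \<le>o weight \<rho>" if "coarsening Y \<rho>" for \<rho>
    using X Y L op that by (rule lattice_transfer_refines)
  fix \<S> assume S: "\<S> \<subseteq> lattice_transfer \<L>"
  let ?R = "\<lambda>\<sigma> \<tau>. closures_saturated \<sigma> \<tau> \<and> densely_approximated \<sigma> \<tau>"
  have co: "coarsening Y \<sigma>" if "\<sigma> \<in> \<S>" for \<sigma> using that S by (auto simp: lattice_transfer_def)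
  show "join (topspace Y) \<S> \<in> lattice_transfer \<L>"
  proof (rule lattice_transfer_join[OF L op co])
    \<comment> \<open>Taking all partners at once avoids a choice: each of them is linked to some member of \<open>\<S>\<close>.\<close>
    show "{\<tau> \<in> \<L>. \<exists>\<sigma>\<in>\<S>. ?R \<sigma> \<tau>} \<subseteq> \<L>" by blast
    show "\<exists>\<tau>\<in>{\<tau> \<in> \<L>. \<exists>\<sigma>\<in>\<S>. ?R \<sigma> \<tau>}. closures_saturated \<sigma> \<tau>" if s: "\<sigma> \<in> \<S>" for \<sigma>
    proof -
      have "\<sigma> \<in> lattice_transfer \<L>" using s S by blast
      then obtain \<tau> where "\<tau> \<in> \<L>" "?R \<sigma> \<tau>" unfolding lattice_transfer_def by blast
      then show ?thesis using s by blast
    qed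
    show "\<exists>\<sigma>\<in>\<S>. densely_approximated \<sigma> \<tau>" if "\<tau> \<in> {\<tau> \<in> \<L>. \<exists>\<sigma>\<in>\<S>. ?R \<sigma> \<tau>}" for \<tau>
      using that by blast
  qed
qed

end

section \<open>Maps as coarser topologies\<close>

definition map_topology :: "'a topology \<Rightarrow> ('a, 'b) top_map \<Rightarrow> 'a topology" where
  "map_topology X \<phi> = pullback_topology (topspace X) (fst \<phi>) (snd \<phi>)"

lemma openin_map_topology:
  "openin (map_topology X \<phi>) U \<longleftrightarrow> (\<exists>V. openin (snd \<phi>) V \<and> U = fst \<phi> -` V \<inter> topspace X)"
  by (simp add: map_topology_def openin_pullback_topology)

lemma onto_mapD:
  assumes "onto_map X \<phi>"
  shows "continuous_map X (snd \<phi>) (fst \<phi>)" "fst \<phi> ` topspace X = topspace (snd \<phi>)"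
    "completely_regular_space (snd \<phi>)" "Hausdorff_space (snd \<phi>)"
    "x \<in> topspace X \<Longrightarrow> fst \<phi> x \<in> topspace (snd \<phi>)"
  using assms unfolding onto_map_def tychonoff_space_def by blast+

lemma topspace_map_topology:
  "onto_map X \<phi> \<Longrightarrow> topspace (map_topology X \<phi>) = topspace X"
  using onto_mapD(2)[of X \<phi>] by (auto simp: map_topology_def topspace_pullback_topology)

lemma coarsening_map_topology:
  assumes \<phi>: "onto_map X \<phi>"
  shows "coarsening X (map_topology X \<phi>)"
  unfolding coarsening_def finer_def
proof (intro conjI allI impI)
  show "topspace X = topspace (map_topology X \<phi>)" using topspace_map_topology[OF \<phi>] by simp
  show "completely_regular_space (map_topology X \<phi>)"
    unfolding map_topology_def
    by (intro completely_regular_space_pullback onto_mapD[OF \<phi>] eq_refl)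
  fix U assume "openin (map_topology X \<phi>) U"
  then obtain V where V: "openin (snd \<phi>) V" "U = fst \<phi> -` V \<inter> topspace X"
    by (auto simp: openin_map_topology)
  have "openin X {x \<in> topspace X. fst \<phi> x \<in> V}"
    using onto_mapD(1)[OF \<phi>] V(1) by (rule openin_continuous_map_preimage)
  moreover have "U = {x \<in> topspace X. fst \<phi> x \<in> V}" using V(2) by auto
  ultimately show "openin X U" by simp
qed

lemma weight_map_topology:
  assumes "onto_map X \<phi>"
  shows "weight (snd \<phi>) \<le>o weight (map_topology X \<phi>)" "weight (map_topology X \<phi>) \<le>o weight (snd \<phi>)"
  unfolding map_topology_def
  by (rule weight_le_pullback[OF onto_mapD(2)[OF assms]], rule weight_pullback_le)

text \<open>
  Points with different images are separated because the range is a Hausdorff space.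
\<close>

lemma indist_map_topology:
  assumes \<phi>: "onto_map X \<phi>" and xy: "x \<in> topspace X" "y \<in> topspace X"
  shows "indist (map_topology X \<phi>) x y \<longleftrightarrow> fst \<phi> x = fst \<phi> y"
proof
  assume "fst \<phi> x = fst \<phi> y"
  then show "indist (map_topology X \<phi>) x y"
    using xy by (auto simp: Kolmogorov_quotient_eq openin_map_topology)
next
  assume ind: "indist (map_topology X \<phi>) x y"
  show "fst \<phi> x = fst \<phi> y"
  proof (rule ccontr)
    assume "fst \<phi> x \<noteq> fst \<phi> y"
    then obtain U V where UV: "openin (snd \<phi>) U" "openin (snd \<phi>) V"
        "fst \<phi> x \<in> U" "fst \<phi> y \<in> V" "disjnt U V"
      using onto_mapD(4,5)[OF \<phi>] xy unfolding Hausdorff_space_def by meson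
    have "openin (map_topology X \<phi>) (fst \<phi> -` U \<inter> topspace X)"
      using UV(1) by (auto simp: openin_map_topology)
    then have "x \<in> fst \<phi> -` U \<inter> topspace X \<longleftrightarrow> y \<in> fst \<phi> -` U \<inter> topspace X"
      using ind unfolding Kolmogorov_quotient_eq by blast
    then show False using UV(3-5) xy by (auto simp: disjnt_def)
  qed
qed

text \<open>
  The factor \<open>g\<close> is well defined since points with equal \<open>\<phi>\<close>-values are indistinguishable for
  the coarser topology of \<open>f\<close>, and continuous since \<open>\<phi>\<close> is onto.
\<close>

lemma map_prec_if_finer:
  assumes \<phi>: "onto_map X \<phi>" and f: "onto_map X f"
    and fine: "finer (map_topology X \<phi>) (map_topology X f)"
  shows "map_prec X \<phi> f"
proof -
  define g where "g z = fst f (inv_into (topspace X) (fst \<phi>) z)" for z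
  have g: "g (fst \<phi> x) = fst f x" if x: "x \<in> topspace X" for x
  proof -
    let ?y = "inv_into (topspace X) (fst \<phi>) (fst \<phi> x)"
    have im: "fst \<phi> x \<in> fst \<phi> ` topspace X" using x by (rule imageI)
    have y: "?y \<in> topspace X" "fst \<phi> ?y = fst \<phi> x"
      using inv_into_into[OF im] f_inv_into_f[OF im] by auto
    then have "indist (map_topology X \<phi>) ?y x" using indist_map_topology[OF \<phi> y(1) x] by simp
    with fine have "indist (map_topology X f) ?y x" by (rule indist_finer)
    then show ?thesis using indist_map_topology[OF f y(1) x] by (simp add: g_def)
  qed
  have "continuous_map (snd \<phi>) (snd f) g"
    unfolding continuous_map_def
  proof (intro conjI allI impI)
    show "g \<in> topspace (snd \<phi>) \<rightarrow> topspace (snd f)"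
      using g onto_mapD(5)[OF f] unfolding onto_mapD(2)[OF \<phi>, symmetric] by auto
    fix V assume V: "openin (snd f) V"
    have "openin (map_topology X f) (fst f -` V \<inter> topspace X)"
      using V by (auto simp: openin_map_topology)
    with fine have "openin (map_topology X \<phi>) (fst f -` V \<inter> topspace X)" by (rule finerD)
    then obtain W where W: "openin (snd \<phi>) W"
        "fst f -` V \<inter> topspace X = fst \<phi> -` W \<inter> topspace X"
      by (auto simp: openin_map_topology)
    have "x \<in> topspace X \<Longrightarrow> g (fst \<phi> x) \<in> V \<longleftrightarrow> fst \<phi> x \<in> W" for x
      using W(2) g[of x] by auto
    then have "{z \<in> topspace (snd \<phi>). g z \<in> V} = W"
      using openin_subset[OF W(1)] unfolding onto_mapD(2)[OF \<phi>, symmetric] by auto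
    then show "openin (snd \<phi>) {z \<in> topspace (snd \<phi>). g z \<in> V}" using W(1) by simp
  qed
  then show ?thesis unfolding map_prec_def using g by (intro exI[of _ g]) simp
qed

lemma finer_if_map_prec:
  assumes \<phi>: "onto_map X \<phi>" and f: "onto_map X f" and prec: "map_prec X \<phi> f"
  shows "finer (map_topology X \<phi>) (map_topology X f)"
proof -
  obtain g where g: "continuous_map (snd \<phi>) (snd f) g" "\<And>x. x \<in> topspace X \<Longrightarrow> fst f x = g (fst \<phi> x)"
    using prec unfolding map_prec_def by blast
  have "openin (map_topology X \<phi>) U" if U: "openin (map_topology X f) U" for U
  proof -
    obtain V where V: "openin (snd f) V" "U = fst f -` V \<inter> topspace X"
      using U by (auto simp: openin_map_topology)
    have "openin (snd \<phi>) {z \<in> topspace (snd \<phi>). g z \<in> V}"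
      using g(1) V(1) by (rule openin_continuous_map_preimage)
    moreover have "U = fst \<phi> -` {z \<in> topspace (snd \<phi>). g z \<in> V} \<inter> topspace X"
      using V(2) g(2) onto_mapD(5)[OF \<phi>] by auto
    ultimately show ?thesis unfolding openin_map_topology by blast
  qed
  then show ?thesis using topspace_map_topology[OF \<phi>] topspace_map_topology[OF f] by (simp add: finer_def)
qed

lemma same_map_sym:
  assumes \<phi>: "onto_map X \<phi>" and same: "same_map X \<phi> \<psi>"
  shows "same_map X \<psi> \<phi>"
proof -
  obtain h where h: "homeomorphic_map (snd \<phi>) (snd \<psi>) h" "\<And>x. x \<in> topspace X \<Longrightarrow> fst \<psi> x = h (fst \<phi> x)"
    using same unfolding same_map_def by blast
  obtain k where k: "homeomorphic_maps (snd \<phi>) (snd \<psi>) h k"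
    using h(1) unfolding homeomorphic_map_maps by blast
  then have "homeomorphic_map (snd \<psi>) (snd \<phi>) k"
    using homeomorphic_maps_sym homeomorphic_maps_imp_map by blast
  moreover have "fst \<phi> x = k (fst \<psi> x)" if "x \<in> topspace X" for x
    using k onto_mapD(5)[OF \<phi> that] h(2)[OF that] unfolding homeomorphic_maps_def by simp
  ultimately show ?thesis unfolding same_map_def by blast
qed

lemma same_map_imp_map_prec: "same_map X \<phi> \<psi> \<Longrightarrow> map_prec X \<phi> \<psi>"
  using homeomorphic_imp_continuous_map unfolding same_map_def map_prec_def by blast

lemma map_topology_same_map:
  assumes \<phi>: "onto_map X \<phi>" and \<psi>: "onto_map X \<psi>" and same: "same_map X \<phi> \<psi>"
  shows "map_topology X \<phi> = map_topology X \<psi>"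
proof -
  have "finer (map_topology X \<phi>) (map_topology X \<psi>)"
    using \<phi> \<psi> same_map_imp_map_prec[OF same] by (rule finer_if_map_prec)
  moreover have "finer (map_topology X \<psi>) (map_topology X \<phi>)"
    using \<psi> \<phi> same_map_imp_map_prec[OF same_map_sym[OF \<phi> same]] by (rule finer_if_map_prec)
  ultimately show ?thesis by (auto simp: topology_eq finer_def)
qed

lemma onto_map_diagonal:
  assumes F: "\<And>\<phi>. \<phi> \<in> F \<Longrightarrow> onto_map X \<phi>"
  shows "onto_map X (diagonal_map X F)"
proof -
  let ?\<Delta> = "\<lambda>x. \<lambda>\<phi>\<in>F. fst \<phi> x"
  let ?P = "product_topology snd F"
  have d: "diagonal_map X F = (?\<Delta>, subtopology ?P (?\<Delta> ` topspace X))"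
    by (simp add: diagonal_map_def Let_def)
  have "continuous_map X ?P ?\<Delta>"
    using onto_mapD(1)[OF F] by (auto simp: continuous_map_componentwise)
  then have c: "continuous_map X (subtopology ?P (?\<Delta> ` topspace X)) ?\<Delta>"
    by (simp add: continuous_map_in_subtopology)
  have "?\<Delta> ` topspace X \<subseteq> topspace ?P" using onto_mapD(5)[OF F] by auto
  then have "?\<Delta> ` topspace X = topspace (subtopology ?P (?\<Delta> ` topspace X))"
    by (simp add: Int_absorb1)
  moreover have "completely_regular_space ?P"
    using onto_mapD(3)[OF F] by (simp add: completely_regular_space_product_topology)
  moreover have "Hausdorff_space ?P"
    using onto_mapD(4)[OF F] by (simp add: Hausdorff_space_product_topology)
  ultimately show ?thesis using c
    by (simp add: onto_map_def d tychonoff_space_def completely_regular_space_subtopology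
        Hausdorff_space_subtopology)
qed

lemma map_topology_diagonal:
  assumes F: "\<And>\<phi>. \<phi> \<in> F \<Longrightarrow> onto_map X \<phi>"
  shows "map_topology X (diagonal_map X F) = join (topspace X) (map_topology X ` F)"
proof -
  let ?\<Delta> = "\<lambda>x. \<lambda>\<phi>\<in>F. fst \<phi> x"
  let ?P = "product_topology snd F"
  have "openin (map_topology X (diagonal_map X F)) U \<longleftrightarrow> openin (pullback_topology (topspace X) ?\<Delta> ?P) U" for U
  proof -
    have eq: "?\<Delta> -` (V \<inter> ?\<Delta> ` topspace X) \<inter> topspace X = ?\<Delta> -` V \<inter> topspace X" for V by auto
    show ?thesis
      unfolding openin_map_topology openin_pullback_topology
      by (auto simp: diagonal_map_def Let_def openin_subtopology eq)
  qed
  then have "map_topology X (diagonal_map X F) = pullback_topology (topspace X) ?\<Delta> ?P"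
    by (simp add: topology_eq)
  also have "\<dots> = join (topspace X) ((\<lambda>\<phi>. pullback_topology (topspace X) (fst \<phi>) (snd \<phi>)) ` F)"
    using onto_mapD(2)[OF F] by (intro pullback_product_eq_join) simp
  finally show ?thesis by (simp add: map_topology_def[abs_def])
qed

text \<open>
  The Kolmogorov quotient of \<open>\<tau>\<close> is completely regular and \<open>T\<^sub>0\<close>, hence a Tychonoff space. It is
  realised on representatives of the classes, so its points have the type of those of \<open>X\<close>.
\<close>

lemma coarsening_is_map_topology:
  fixes X :: "'a topology"
  assumes \<tau>: "coarsening X \<tau>"
  shows "\<exists>\<phi> :: ('a, 'a) top_map. onto_map X \<phi> \<and> map_topology X \<phi> = \<tau>"
proof -
  let ?k = "Kolmogorov_quotient \<tau>"
  let ?Z = "subtopology \<tau> (?k ` topspace \<tau>)"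
  have top: "topspace \<tau> = topspace X" using \<tau> by (rule coarseningD)
  have cr: "completely_regular_space ?Z"
    using coarseningD(3)[OF \<tau>] by (rule completely_regular_space_subtopology)
  have "tychonoff_space ?Z"
    unfolding tychonoff_space_def
    using cr completely_regular_imp_regular_space[OF cr] t0_space_Kolmogorov_quotient
    by (blast intro: regular_t0_imp_Hausdorff_space)
  moreover have "continuous_map \<tau> ?Z ?k"
    using quotient_map_Kolmogorov_quotient by (rule quotient_imp_continuous_map)
  then have "continuous_map X ?Z ?k"
    using coarseningD(2)[OF \<tau>] top by (simp add: continuous_map_def)
  moreover have "?k ` topspace X = topspace ?Z"
    using quotient_imp_surjective_map[OF quotient_map_Kolmogorov_quotient] by (metis top)
  ultimately have "onto_map X (?k, ?Z)" by (simp add: onto_map_def)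
  moreover have "openin (map_topology X (?k, ?Z)) U \<longleftrightarrow> openin \<tau> U" for U
  proof -
    have eq: "?k -` (V \<inter> ?k ` topspace \<tau>) \<inter> topspace X = V" if V: "openin \<tau> V" for V
      using openin_subset[OF V] Kolmogorov_quotient_in_open[OF V] top by auto
    have "openin (map_topology X (?k, ?Z)) U \<longleftrightarrow>
        (\<exists>V. openin \<tau> V \<and> U = ?k -` (V \<inter> ?k ` topspace \<tau>) \<inter> topspace X)"
      by (auto simp: openin_map_topology openin_subtopology)
    then show ?thesis using eq by auto
  qed
  then have "map_topology X (?k, ?Z) = \<tau>" by (simp add: topology_eq)
  ultimately show ?thesis by blast
qed

lemma topology_lattice_of_multiplicative_lattice:
  fixes X :: "'a topology"
  assumes \<Psi>: "multiplicative_lattice X \<Psi>"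
  shows "topology_lattice X (map_topology X ` \<Psi>)"
  unfolding topology_lattice_def
proof (intro conjI ballI allI impI)
  have onto: "onto_map X \<phi>" if "\<phi> \<in> \<Psi>" for \<phi>
    using \<Psi> that unfolding multiplicative_lattice_def by blast
  show "coarsening X \<tau>" if "\<tau> \<in> map_topology X ` \<Psi>" for \<tau>
    using that onto coarsening_map_topology by blast
  show "\<exists>\<tau>\<in>map_topology X ` \<Psi>. finer \<tau> \<sigma> \<and> weight \<tau> \<le>o weight \<sigma>" if \<sigma>: "coarsening X \<sigma>" for \<sigma>
  proof -
    obtain f :: "('a, 'a) top_map" where f: "onto_map X f" "map_topology X f = \<sigma>"
      using coarsening_is_map_topology[OF \<sigma>] by blast
    then obtain \<phi> where \<phi>: "\<phi> \<in> \<Psi>" "map_prec X \<phi> f" "weight (snd \<phi>) \<le>o weight (snd f)"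
      using \<Psi> unfolding multiplicative_lattice_def by blast
    have "finer (map_topology X \<phi>) \<sigma>"
      using finer_if_map_prec[OF onto[OF \<phi>(1)] f(1) \<phi>(2)] f(2) by simp
    moreover have "weight (map_topology X \<phi>) \<le>o weight (snd f)"
      using weight_map_topology(2)[OF onto[OF \<phi>(1)]] \<phi>(3) by (rule ordLeq_transitive)
    then have "weight (map_topology X \<phi>) \<le>o weight \<sigma>"
      using weight_map_topology(1)[OF f(1)] unfolding f(2) by (rule ordLeq_transitive)
    ultimately show ?thesis using \<phi>(1) by blast
  qed
  fix \<T> assume "\<T> \<subseteq> map_topology X ` \<Psi>"
  then obtain F where F: "F \<subseteq> \<Psi>" "\<T> = map_topology X ` F" by (meson subset_imageE)
  then obtain \<psi> where \<psi>: "\<psi> \<in> \<Psi>" "same_map X \<psi> (diagonal_map X F)"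
    using \<Psi> unfolding multiplicative_lattice_def by blast
  have oF: "onto_map X \<phi>" if "\<phi> \<in> F" for \<phi> using that F(1) onto by blast
  have "map_topology X \<psi> = map_topology X (diagonal_map X F)"
    using onto[OF \<psi>(1)] onto_map_diagonal[OF oF] \<psi>(2) by (rule map_topology_same_map)
  also have "\<dots> = join (topspace X) \<T>"
    using map_topology_diagonal[OF oF] F(2) by simp
  finally show "join (topspace X) \<T> \<in> map_topology X ` \<Psi>" using \<psi>(1) by (metis imageI)
qed

lemma multiplicative_lattice_of_topology_lattice:
  fixes X :: "'a topology"
  assumes L: "topology_lattice X \<L>"
  shows "multiplicative_lattice X {\<phi>. onto_map X \<phi> \<and> map_topology X \<phi> \<in> \<L>}"
  unfolding multiplicative_lattice_def
proof (intro conjI ballI allI impI)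
  let ?\<Phi> = "{\<phi> :: ('a, 'a) top_map. onto_map X \<phi> \<and> map_topology X \<phi> \<in> \<L>}"
  show "onto_map X \<phi>" if "\<phi> \<in> ?\<Phi>" for \<phi> using that by blast
  show "\<exists>\<phi>\<in>?\<Phi>. map_prec X \<phi> f \<and> weight (snd \<phi>) \<le>o weight (snd f)"
    if f: "onto_map X f" for f :: "('a, 'a) top_map"
  proof -
    obtain \<tau> where \<tau>: "\<tau> \<in> \<L>" "finer \<tau> (map_topology X f)" "weight \<tau> \<le>o weight (map_topology X f)"
      using topology_latticeD(2)[OF L coarsening_map_topology[OF f]] by blast
    obtain \<phi> :: "('a, 'a) top_map" where \<phi>: "onto_map X \<phi>" "map_topology X \<phi> = \<tau>"
      using coarsening_is_map_topology[OF topology_latticeD(1)[OF L \<tau>(1)]] by blast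
    have "map_prec X \<phi> f" using \<phi> f \<tau>(2) by (intro map_prec_if_finer) simp_all
    moreover have "weight (snd \<phi>) \<le>o weight (map_topology X f)"
      using weight_map_topology(1)[OF \<phi>(1)] \<tau>(3) unfolding \<phi>(2) by (rule ordLeq_transitive)
    then have "weight (snd \<phi>) \<le>o weight (snd f)"
      using weight_map_topology(2)[OF f] by (rule ordLeq_transitive)
    moreover have "\<phi> \<in> ?\<Phi>" using \<phi> \<tau>(1) by simp
    ultimately show ?thesis by blast
  qed
  fix F assume F: "F \<subseteq> ?\<Phi>"
  have oF: "onto_map X \<phi>" if "\<phi> \<in> F" for \<phi> using that F by blast
  obtain \<psi> :: "('a, 'a) top_map" where \<psi>: "onto_map X \<psi>" "same_map X (diagonal_map X F) \<psi>"
    using onto_map_representable[OF onto_map_diagonal[OF oF]] by blast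
  have "map_topology X \<psi> = map_topology X (diagonal_map X F)"
    using map_topology_same_map[OF onto_map_diagonal[OF oF] \<psi>] by simp
  also have "\<dots> = join (topspace X) (map_topology X ` F)"
    by (rule map_topology_diagonal[OF oF])
  also have "\<dots> \<in> \<L>" using F by (intro topology_latticeD(3)[OF L]) blast
  finally have "\<psi> \<in> ?\<Phi>" using \<psi>(1) by simp
  moreover have "same_map X \<psi> (diagonal_map X F)"
    using onto_map_diagonal[OF oF] \<psi>(2) by (rule same_map_sym)
  ultimately show "\<exists>\<psi>\<in>?\<Phi>. same_map X \<psi> (diagonal_map X F)" by blast
qed

lemma saturation_map_topology:
  assumes \<phi>: "onto_map X \<phi>" and U: "U \<subseteq> topspace X"
  shows "saturation (map_topology X \<phi>) U = fst \<phi> -` (fst \<phi> ` U) \<inter> topspace X"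
  using indist_map_topology[OF \<phi>] U unfolding saturation_def topspace_map_topology[OF \<phi>] by fastforce

lemma open_coarsening_map_topology:
  assumes \<phi>: "onto_map X \<phi>" and op: "open_map X (snd \<phi>) (fst \<phi>)"
  shows "open_coarsening X (map_topology X \<phi>)"
  unfolding open_coarsening_def
proof (intro conjI allI impI)
  show "coarsening X (map_topology X \<phi>)" using \<phi> by (rule coarsening_map_topology)
  fix U assume U: "openin X U"
  then have "openin (snd \<phi>) (fst \<phi> ` U)" using op unfolding open_map_def by blast
  then show "openin (map_topology X \<phi>) (saturation (map_topology X \<phi>) U)"
    unfolding saturation_map_topology[OF \<phi> openin_subset[OF U]] openin_map_topology by blast
qed

text \<open>
  A set of the induced topology inside the saturation of \<open>U\<close> is the preimage of an open set
  inside the image of \<open>U\<close>.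
\<close>

lemma semi_open_mapI:
  assumes \<phi>: "onto_map X \<phi>"
    and W: "\<And>U. openin X U \<Longrightarrow> U \<noteq> {} \<Longrightarrow>
      \<exists>W. openin (map_topology X \<phi>) W \<and> W \<noteq> {} \<and> W \<subseteq> saturation (map_topology X \<phi>) U"
  shows "semi_open_map X (snd \<phi>) (fst \<phi>)"
  unfolding semi_open_map_def
proof (intro allI impI, elim conjE)
  fix U assume U: "openin X U" "U \<noteq> {}"
  then obtain W where W: "openin (map_topology X \<phi>) W" "W \<noteq> {}"
      "W \<subseteq> fst \<phi> -` (fst \<phi> ` U) \<inter> topspace X"
    using assms(2)[OF U] unfolding saturation_map_topology[OF \<phi> openin_subset[OF U(1)]] by blast
  then obtain V where V: "openin (snd \<phi>) V" "W = fst \<phi> -` V \<inter> topspace X"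
    by (auto simp: openin_map_topology)
  have "V \<subseteq> fst \<phi> ` U"
  proof
    fix z assume z: "z \<in> V"
    then have "z \<in> fst \<phi> ` topspace X" using openin_subset[OF V(1)] onto_mapD(2)[OF \<phi>] by blast
    then obtain x where "x \<in> topspace X" "z = fst \<phi> x" by blast
    then show "z \<in> fst \<phi> ` U" using W(3) V(2) z by blast
  qed
  then have "V \<subseteq> snd \<phi> interior_of (fst \<phi> ` U)" using V(1) by (rule interior_of_maximal)
  moreover have "V \<noteq> {}" using W(2) V(2) by blast
  ultimately show "snd \<phi> interior_of (fst \<phi> ` U) \<noteq> {}" by blast
qed

section \<open>Lattices on co-absolute spaces\<close>

theorem theorem2p2:
  fixes X :: "'a topology" and Y :: "'b topology"
    and E\<^sub>X :: "'c topology" and E\<^sub>Y :: "'d topology"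
  assumes "tychonoff_space X" and "tychonoff_space Y"
    and "\<exists>\<Psi>. multiplicative_lattice_of_open_maps X \<Psi>"
    and "is_absolute E\<^sub>X X" and "is_absolute E\<^sub>Y Y"
    and "E\<^sub>X homeomorphic_space E\<^sub>Y"
  shows "\<exists>\<Phi>. multiplicative_lattice_of_semi_open_maps Y \<Phi>"
proof -
  have X: "completely_regular_space X" and Y: "completely_regular_space Y"
    using assms(1,2) by (simp_all add: tychonoff_space_def)
  obtain \<Psi> where \<Psi>: "multiplicative_lattice X \<Psi>" "\<And>\<phi>. \<phi> \<in> \<Psi> \<Longrightarrow> open_map X (snd \<phi>) (fst \<phi>)"
    using assms(3) unfolding multiplicative_lattice_of_open_maps_def by blast
  obtain p where p: "perfect_map E\<^sub>X X p" "irreducible_map E\<^sub>X X p"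
    using assms(4) unfolding is_absolute_def by blast
  obtain q where q: "perfect_map E\<^sub>Y Y q" "irreducible_map E\<^sub>Y Y q"
    using assms(5) unfolding is_absolute_def by blast
  obtain h where h: "homeomorphic_map E\<^sub>X E\<^sub>Y h"
    using assms(6) unfolding homeomorphic_space by blast
  have fibres: "compactin E\<^sub>X {e \<in> topspace E\<^sub>X. p e = x}" if "x \<in> topspace X" for x
    using p(1) that by (simp add: perfect_map_def proper_map_def)
  have "closed_irreducible E\<^sub>X X p" "closed_irreducible E\<^sub>Y Y q"
    using p q by (simp_all add: closed_irreducible_def perfect_map_def proper_map_def)
  then interpret roof E\<^sub>X X Y p "q \<circ> h"
    using closed_irreducible_comp_homeomorphic[OF h] by (simp add: roof_def)
  let ?\<L> = "map_topology X ` \<Psi>"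
  have L: "topology_lattice X ?\<L>"
    using \<Psi>(1) by (rule topology_lattice_of_multiplicative_lattice)
  have "onto_map X \<phi>" if "\<phi> \<in> \<Psi>" for \<phi>
    using \<Psi>(1) that unfolding multiplicative_lattice_def by blast
  then have op: "\<forall>\<tau>\<in>?\<L>. open_coarsening X \<tau>"
    using \<Psi>(2) open_coarsening_map_topology by blast
  let ?\<Phi> = "{\<phi> :: ('b, 'b) top_map. onto_map Y \<phi> \<and> map_topology Y \<phi> \<in> lattice_transfer ?\<L>}"
  have "multiplicative_lattice Y ?\<Phi>"
    using topology_lattice_transfer[OF X Y L op] by (rule multiplicative_lattice_of_topology_lattice)
  moreover have "semi_open_map Y (snd \<phi>) (fst \<phi>)" if \<phi>: "\<phi> \<in> ?\<Phi>" for \<phi>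
  proof (rule semi_open_mapI)
    show "onto_map Y \<phi>" using \<phi> by simp
    fix U assume U: "openin Y U" "U \<noteq> {}"
    obtain \<tau> where \<tau>: "coarsening Y (map_topology Y \<phi>)" "\<tau> \<in> ?\<L>"
        "closures_saturated (map_topology Y \<phi>) \<tau>" "densely_approximated (map_topology Y \<phi>) \<tau>"
      using \<phi> unfolding lattice_transfer_def by blast
    then show "\<exists>W. openin (map_topology Y \<phi>) W \<and> W \<noteq> {} \<and> W \<subseteq> saturation (map_topology Y \<phi>) U"
      using op fibres U by (intro semi_open_coarsening) auto
  qed
  ultimately show ?thesis
    unfolding multiplicative_lattice_of_semi_open_maps_def by (intro exI[of _ ?\<Phi>]) simp
qed

end
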